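(* Let $\mu$ be a probability measure on $\mathbb{R}^d$ with compact support $\mathbf{\Omega}$ and density $f$ with respect to the Lebesgue measure, and suppose that for every $\emptyset\neq A\subseteq[d]$: (i) $\mathbf{\Omega}_A=\mathrm{cl}(\mathrm{int}(\mathbf{\Omega}_A))$; (ii) the marginal density $f_A$ is continuous and positive on $\mathrm{int}(\mathbf{\Omega}_A)$; (iii) $f_A=0$ outside of $\mathbf{\Omega}_A$. Let $G$ be a graphical model for $\mu$, with junction tree $J$. Let $\mathbf{x}\in\mathbb{R}^d$ be fixed and assume that $\mathbf{x}_A\notin\partial\mathbf{\Omega}_A$ for every $\emptyset\neq A\subseteq[d]$. Then there is a constant $\alpha>0$ such that, as $n\to\infty$, $$\Gamma_n^{\mu,G,J}(\mathbf{x})=\begin{cases}O(n^{d^2}) & \text{if } \mathbf{x}\in\mathrm{int}(\mathbf{\Omega}),\\ \Omega(\exp(\alpha\cdot n)) & \text{if } \mathbf{x}\notin\mathbf{\Omega},\end{cases}$$ where $\Gamma_n^{\mu,G,J}$ is the rational Christoffel function of $\mu$ associated with $G$ and $J$.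
   Context: Notation. $[d]=\{1,\dots,d\}$. For $A\subseteq[d]$, $\mathbb{R}^d_A$ is the span of the standard basis vectors $e_k$, $k\in A$; $\mathbf{x}_A=(x_k)_{k\in A}\in\mathbb{R}^d_A$ is the projection of $\mathbf{x}\in\mathbb{R}^d$; $\mathbf{\Omega}_A=\{\mathbf{x}_A:\mathbf{x}\in\mathbf{\Omega}\}$. Closure $\mathrm{cl}$, interior $\mathrm{int}$ and boundary $\partial$ of $\mathbf{\Omega}_A$ are taken in $\mathbb{R}^d_A$. $\mu_A$ is the marginal of $\mu$ on $\mathbb{R}^d_A$, with density $f_A(\mathbf{x}_A)=\int f(\mathbf{x}_A,\mathbf{x}_{[d]\setminus A})\,d\mathbf{x}_{[d]\setminus A}$ (and $f_\emptyset=1$). In the asymptotic notation $O(\cdot)$, $\Omega(\cdot)$ (the latter not to be confused with the set $\mathbf{\Omega}$), constants may depend on everything except $n$ (in particular on $\mathbf{x}$). Graphical models. For $A,B,C\subseteq[d]$, $A\perp_\mu B\,|\,C$ (conditional independence) means $f_C(\mathbf{x}_C)\,f_{A\cup B\cup C}(\mathbf{x}_{A\cup B\cup C})=f_{A\cup C}(\mathbf{x}_{A\cup C})\,f_{B\cup C}(\mathbf{x}_{B\cup C})$, as an identity of densities (for almost every $\mathbf{x}$). In a simple graph $G$ on vertex set $[d]$, $A,B$ are separated by $C$ if every path (including one-vertex paths) between a vertex of $A$ and a vertex of $B$ contains a vertex of $C$. $G$ is a graphical model for $\mu$ if for all $A,B,C\subseteq[d]$: $A,B$ separated by $C$ in $G$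 implies $A\perp_\mu B\,|\,C$. Junction trees. A graph is chordal if every cycle of length greater than 3 has a chord. A chordal completion of $G$ is a chordal graph $\overline G$ on the same vertex set with $E(G)\subseteq E(\overline G)$. A junction tree $J$ for $G$ is a tree whose vertex set $V(J)$ is the set of maximal cliques of some chordal completion of $G$, with the clique-intersection property: for every $C\in V(J)$ on the path between $A,B\in V(J)$ in $J$, $A\cap B\subseteq C$. $E(J)$ denotes its edge set. Christoffel polynomials. For $D\subseteq[d]$ and $n\in\mathbb{N}$, $\mathbb{R}[\mathbf{x}_D]_{\otimes n}$ is the space of real polynomials in the variables $x_k$, $k\in D$, of degree at most $n$ in each variable. The coordinate-wise Christoffel polynomial of $\mu_D$ is $\Lambda_{\otimes n}^{\mu_D}(\mathbf{x}_D)=\sum_k P_k(\mathbf{x}_D)^2$, where $\{P_k\}$ is any orthonormal basis of $\mathbb{R}[\mathbf{x}_D]_{\otimes n}$ for the inner product $\langle p,q\rangle_{\mu_D}=\int pq\,d\mu_D$; equivalently $\Lambda_{\otimes n}^{\mu_D}(\mathbf{z})^{-1}=\min\{\int p^2d\mu_D: p\in\mathbb{R}[\mathbf{x}_D]_{\otimes n},\ p(\mathbf{z})=1\}$. For $D=\emptyset$, $\Lambda_{\otimes n}^{\mu_\emptyset}=1$. Rational Christoffel function: $$\Gamma_n^{\mu,G,J}(\mathbf{x})=\frac{\prod_{C\in V(J)}\Lambda_{\otimes n}^{\mu_C}(\mathbf{x}_C)}{\prod_{\{A,B\}\in E(J)}\Lambda_{\otimes n}^{\mu_{A\cap B}}(\mathbf{x}_{A\cap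 B})}.$$ *)

theory Defs
  imports
    "HOL-Probability.Probability"
    "HOL-Library.Landau_Symbols"
    "Graph_Theory.Pair_Digraph"
    "Graph_Theory.Digraph_Component_Vwalk"
begin

text \<open>
  For a finite set \<open>A\<close> of naturals, the coordinate space of \<open>A\<close> (the span of the basis
  vectors with index in \<open>A\<close>) is \<open>A \<rightarrow>\<^sub>E UNIV\<close>, with topology \<open>powertop_real A\<close>, Lebesgue measure
  \<open>lebesgue_on_coords A\<close> and projection \<open>\<lambda>x. restrict x A\<close>. The full space is the case
  \<open>A = {1..d}\<close>.
\<close>

abbreviation lebesgue_on_coords :: "nat set \<Rightarrow> (nat \<Rightarrow> real) measure" where
  "lebesgue_on_coords A \<equiv> Pi\<^sub>M A (\<lambda>_. lborel)"

definition proj_set :: "nat set \<Rightarrow> (nat \<Rightarrow> real) set \<Rightarrow> (nat \<Rightarrow> real) set" where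
  "proj_set A S = (\<lambda>x. restrict x A) ` S"

definition measure_support :: "'a topology \<Rightarrow> 'a measure \<Rightarrow> 'a set" where
  "measure_support X M = {x \<in> topspace X. \<forall>U. openin X U \<and> x \<in> U \<longrightarrow> emeasure M U > 0}"

definition marginal :: "(nat \<Rightarrow> real) measure \<Rightarrow> nat set \<Rightarrow> (nat \<Rightarrow> real) measure" where
  "marginal \<mu> A = distr \<mu> (lebesgue_on_coords A) (\<lambda>x. restrict x A)"

definition marginal_density ::
    "nat \<Rightarrow> ((nat \<Rightarrow> real) \<Rightarrow> real) \<Rightarrow> nat set \<Rightarrow> (nat \<Rightarrow> real) \<Rightarrow> real" where
  "marginal_density d f A x =
     (\<integral>y. f (merge A ({1..d} - A) (x, y)) \<partial>lebesgue_on_coords ({1..d} - A))"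


text \<open>
  A finite simple graph is a \<open>pair_graph\<close>, whose edges are the pairs \<open>(u, v)\<close> in a symmetric,
  irreflexive relation. The notions \<open>cycle\<close>, \<open>forest\<close> and \<open>tree\<close> of the graph library are
  about directed graphs: there, traversing one undirected edge back and forth is already a
  cycle. Hence the undirected versions below.
\<close>

definition undirected_cycle :: "'a pair_pre_digraph \<Rightarrow> 'a list \<Rightarrow> bool" where
  "undirected_cycle G p \<longleftrightarrow>
     vpath p (with_proj G) \<and> length p \<ge> 3 \<and> (last p, hd p) \<in> parcs G"

definition undirected_tree :: "'a pair_pre_digraph \<Rightarrow> bool" where
  "undirected_tree G \<longleftrightarrow>
     pair_graph G \<and> Digraph_Component.connected (with_proj G) \<and> (\<nexists>p. undirected_cycle G p)"

definition undirected_edges :: "'a pair_pre_digraph \<Rightarrow> 'a set set" where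
  "undirected_edges G = {{u, v} | u v. (u, v) \<in> parcs G}"

definition separated :: "'a pair_pre_digraph \<Rightarrow> 'a set \<Rightarrow> 'a set \<Rightarrow> 'a set \<Rightarrow> bool" where
  "separated G A B C \<longleftrightarrow>
     (\<forall>p. vpath p (with_proj G) \<and> hd p \<in> A \<and> last p \<in> B \<longrightarrow> set p \<inter> C \<noteq> {})"

definition has_chord :: "'a pair_pre_digraph \<Rightarrow> 'a list \<Rightarrow> bool" where
  "has_chord G p \<longleftrightarrow>
     (\<exists>i j. i < j \<and> j < length p \<and> j \<noteq> Suc i \<and> \<not> (i = 0 \<and> j = length p - 1) \<and>
            (p ! i, p ! j) \<in> parcs G)"

definition chordal :: "'a pair_pre_digraph \<Rightarrow> bool" where
  "chordal G \<longleftrightarrow> (\<forall>p. undirected_cycle G p \<and> length p > 3 \<longrightarrow> has_chord G p)"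

definition chordal_completion :: "'a pair_pre_digraph \<Rightarrow> 'a pair_pre_digraph \<Rightarrow> bool" where
  "chordal_completion G H \<longleftrightarrow>
     pair_graph H \<and> chordal H \<and> pverts H = pverts G \<and> parcs G \<subseteq> parcs H"

definition clique :: "'a pair_pre_digraph \<Rightarrow> 'a set \<Rightarrow> bool" where
  "clique G K \<longleftrightarrow> K \<subseteq> pverts G \<and> (\<forall>u\<in>K. \<forall>v\<in>K. u \<noteq> v \<longrightarrow> (u, v) \<in> parcs G)"

definition maximal_cliques :: "'a pair_pre_digraph \<Rightarrow> 'a set set" where
  "maximal_cliques G = {K. clique G K \<and> (\<forall>L. clique G L \<and> K \<subseteq> L \<longrightarrow> L = K)}"

definition junction_tree :: "'a pair_pre_digraph \<Rightarrow> 'a set pair_pre_digraph \<Rightarrow> bool" where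
  "junction_tree G J \<longleftrightarrow>
     undirected_tree J \<and>
     (\<exists>H. chordal_completion G H \<and> pverts J = maximal_cliques H) \<and>
     (\<forall>p. vpath p (with_proj J) \<longrightarrow> (\<forall>C\<in>set p. hd p \<inter> last p \<subseteq> C))"


definition cond_indep ::
    "nat \<Rightarrow> ((nat \<Rightarrow> real) \<Rightarrow> real) \<Rightarrow> nat set \<Rightarrow> nat set \<Rightarrow> nat set \<Rightarrow> bool" where
  "cond_indep d f A B C \<longleftrightarrow>
     (AE x in lebesgue_on_coords {1..d}.
        marginal_density d f C (restrict x C) *
          marginal_density d f (A \<union> B \<union> C) (restrict x (A \<union> B \<union> C)) =
        marginal_density d f (A \<union> C) (restrict x (A \<union> C)) *
          marginal_density d f (B \<union> C) (restrict x (B \<union> C)))"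

definition graphical_model ::
    "nat \<Rightarrow> ((nat \<Rightarrow> real) \<Rightarrow> real) \<Rightarrow> nat pair_pre_digraph \<Rightarrow> bool" where
  "graphical_model d f G \<longleftrightarrow>
     pair_graph G \<and> pverts G = {1..d} \<and>
     (\<forall>A B C. A \<subseteq> {1..d} \<and> B \<subseteq> {1..d} \<and> C \<subseteq> {1..d} \<and> separated G A B C \<longrightarrow>
        cond_indep d f A B C)"


text \<open>
  Real polynomials in the variables with index in \<open>D\<close>, of degree at most \<open>n\<close> in each variable,
  as functions: \<open>m\<close> ranges over the exponent vectors. For \<open>D = {}\<close> these are the constants.
\<close>

definition coordwise_polys :: "nat set \<Rightarrow> nat \<Rightarrow> ((nat \<Rightarrow> real) \<Rightarrow> real) set" where
  "coordwise_polys D n =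
     {p. \<exists>c. p = (\<lambda>x. \<Sum>m\<in>D \<rightarrow>\<^sub>E {..n}. c m * (\<Prod>k\<in>D. x k ^ m k))}"

definition orthonormal_poly_basis ::
    "nat set \<Rightarrow> nat \<Rightarrow> (nat \<Rightarrow> real) measure \<Rightarrow> ((nat \<Rightarrow> real) \<Rightarrow> real) set \<Rightarrow> bool" where
  "orthonormal_poly_basis D n \<nu> P \<longleftrightarrow>
     finite P \<and> P \<subseteq> coordwise_polys D n \<and>
     (\<forall>p\<in>P. \<forall>q\<in>P. (\<integral>x. p x * q x \<partial>\<nu>) = (if p = q then 1 else 0)) \<and>
     (\<forall>q\<in>coordwise_polys D n. \<exists>c. q = (\<lambda>x. \<Sum>p\<in>P. c p * p x))"

text \<open>
  The choice of the basis does not affect the sum. A basis exists when \<open>\<nu>\<close> has compact support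
  and a density that is positive on a nonempty open set, since then the inner product is
  positive definite on polynomials. For \<open>D = {}\<close> and a probability measure the value is 1.
\<close>

definition christoffel_poly ::
    "nat set \<Rightarrow> nat \<Rightarrow> (nat \<Rightarrow> real) measure \<Rightarrow> (nat \<Rightarrow> real) \<Rightarrow> real" where
  "christoffel_poly D n \<nu> z = (\<Sum>p\<in>(SOME P. orthonormal_poly_basis D n \<nu> P). (p z)\<^sup>2)"

text \<open>
  For an edge \<open>e = {A, B}\<close> of the junction tree, \<open>\<Inter>e = A \<inter> B\<close>. The graph enters only
  through its junction tree \<open>J\<close>.
\<close>

definition rational_christoffel ::
    "(nat \<Rightarrow> real) measure \<Rightarrow> nat set pair_pre_digraph \<Rightarrow> nat \<Rightarrow> (nat \<Rightarrow> real) \<Rightarrow> real" where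
  "rational_christoffel \<mu> J n x =
     (\<Prod>C\<in>pverts J. christoffel_poly C n (marginal \<mu> C) (restrict x C)) /
     (\<Prod>e\<in>undirected_edges J. christoffel_poly (\<Inter>e) n (marginal \<mu> (\<Inter>e)) (restrict x (\<Inter>e)))"

end

theory Submission
  imports Defs "HOL-Computational_Algebra.Polynomial"
begin

text \<open>
  Write \<open>\<Lambda>\<^sub>D\<close> for the Christoffel polynomial of the marginal on \<open>D\<close>, at the projection of \<open>x\<close>. It is the
  least \<open>M\<close> with \<open>q(x)\<^sup>2 \<le> M \<integral>q\<^sup>2 d\<mu>\<close> for all polynomials \<open>q\<close> in the variables of \<open>D\<close> of degree at
  most \<open>n\<close> in each of them. Since constants are such polynomials, and polynomials in fewer variables
  are polynomials in more variables, \<open>1 \<le> \<Lambda>\<^sub>D \<le> \<Lambda>\<^sub>C\<close> whenever \<open>D \<subseteq> C\<close>.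

  Root the junction tree at any of its cliques. Its edges are then the pairs of a clique \<open>C\<close> other than
  the root and its parent \<open>P\<close>, so the rational Christoffel function is the product of \<open>\<Lambda>\<close> at the root
  and of the quotients of \<open>\<Lambda>\<^sub>C\<close> by the value at \<open>C \<inter> P\<close>. All quotients are at least 1 and all
  denominators are at least 1. Hence, whichever clique is the root, the rational Christoffel function
  lies between \<open>\<Lambda>\<close> at the root (\<open>christoffel_root_le_rational\<close>) and the product of the \<open>\<Lambda>\<^sub>C\<close> over all
  cliques (\<open>rational_christoffel_bounds\<close>).

  If \<open>x\<close> is interior, the marginal density is bounded below on a box around each projection of \<open>x\<close>.
  A univariate polynomial of degree at most \<open>n\<close> satisfies \<open>p(c)\<^sup>2 = O(n) \<integral>p\<^sup>2\<close> with the integral over an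
  interval centred at \<open>c\<close> (\<open>poly_midpoint_square_le\<close>); one coordinate after the other, this gives
  \<open>\<Lambda>\<^sub>C = O(n\<^bsup>|C|\<^esup>)\<close>. For \<open>d > 0\<close> there are at most \<open>d\<close> cliques (\<open>junction_tree_card_le\<close>), each of size
  at most \<open>d\<close>, whence the exponent \<open>d\<^sup>2\<close>.

  If \<open>x\<close> is outside the support, some clique \<open>C\<close> already sees this: the projection of \<open>x\<close> on \<open>C\<close> is
  outside the projection of the support (\<open>exterior_clique\<close>). Otherwise all clique marginals would be
  positive near \<open>x\<close>, and conditional independence along the junction tree would make the density
  itself positive there (\<open>density_nonzero_of_clique_marginals\<close>). With this \<open>C\<close> as root it remains to see
  that \<open>\<Lambda>\<^sub>C\<close> grows exponentially, and powers of \<open>1 - |y - x|\<^sup>2 / L\<close> show that: they are 1 at \<open>x\<close> and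
  exponentially small on the support (\<open>christoffel_exponential_growth\<close>).
\<close>

section \<open>Enumerating the nodes of a tree from a root\<close>

text \<open>
  The root comes first, and \<open>par\<close> acts on positions in the list. The last clause is how
  acyclicity enters: each node is joined to its parent only, among the earlier nodes.
\<close>

definition parent_enumeration :: "'a pair_pre_digraph \<Rightarrow> 'a list \<Rightarrow> (nat \<Rightarrow> nat) \<Rightarrow> bool" where
  "parent_enumeration T cs par \<longleftrightarrow>
     distinct cs \<and> set cs \<subseteq> pverts T \<and>
     (\<forall>i<length cs. 0 < i \<longrightarrow>
        par i < i \<and> (cs ! par i, cs ! i) \<in> parcs T \<and>
        (\<forall>j<i. (cs ! j, cs ! i) \<in> parcs T \<longrightarrow> j = par i))"

lemma parent_enumerationD:
  assumes "parent_enumeration T cs par" "i < length cs" "0 < i"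
  shows "par i < i" "(cs ! par i, cs ! i) \<in> parcs T"
    "\<And>j. j < i \<Longrightarrow> (cs ! j, cs ! i) \<in> parcs T \<Longrightarrow> j = par i"
  using assms by (auto simp: parent_enumeration_def)

lemma pair_graph_sym: "pair_graph T \<Longrightarrow> (u, v) \<in> parcs T \<Longrightarrow> (v, u) \<in> parcs T"
  unfolding pair_graph_def pair_pseudo_graph_def pair_sym_digraph_def pair_sym_digraph_axioms_def
    symmetric_def by (auto dest: symD)

lemma pair_graph_verts:
  assumes "pair_graph T" "(u, v) \<in> parcs T"
  shows "u \<in> pverts T" "v \<in> pverts T" "u \<noteq> v"
proof -
  interpret pair_graph T by fact
  show "u \<in> pverts T" "v \<in> pverts T" "u \<noteq> v"
    using wellformed'[OF assms(2)] pair_no_loops[OF assms(2)] by auto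
qed

lemma pair_graph_finite: "pair_graph T \<Longrightarrow> finite (pverts T)"
  by (simp add: pair_graph_def pair_digraph_def pair_fin_digraph_def pair_fin_digraph_axioms_def)

lemma vpath_snoc:
  assumes "vpath p (with_proj T)" "(last p, v) \<in> parcs T" "v \<in> pverts T" "v \<notin> set p"
  shows "vpath (p @ [v]) (with_proj T)"
  using assms by (auto simp: vpath_def vwalk_def vwalk_arcs_append)

lemma vpath_Cons:
  assumes "vpath p (with_proj T)" "(v, hd p) \<in> parcs T" "v \<in> pverts T" "v \<notin> set p"
  shows "vpath (v # p) (with_proj T)"
  using assms by (auto simp: vpath_def vwalk_def)

lemma image_nth_lessThan: "(!) cs ` {..<length cs} = set cs"
  by (auto simp: set_conv_nth)

text \<open>
  An initial segment of the enumeration is connected in itself. Its last node is a leaf of it, so a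
  path that ends at the parent of that node can be prolonged to it and remains a path.
\<close>

lemma parent_enumeration_vpath:
  assumes T: "pair_graph T" and cs: "parent_enumeration T cs par"
    and "m \<le> length cs" "j < m" "k < m"
  shows "\<exists>p. vpath p (with_proj T) \<and> hd p = cs ! j \<and> last p = cs ! k \<and> set p \<subseteq> (!) cs ` {..<m}"
  using assms(3-5)
proof (induction m arbitrary: j k)
  case (Suc m)
  have new: "cs ! m \<notin> (!) cs ` {..<m}" "cs ! m \<in> pverts T"
    using cs Suc.prems(1) by (auto simp: parent_enumeration_def nth_eq_iff_index_eq)
  have mono: "(!) cs ` {..<m} \<subseteq> (!) cs ` {..<Suc m}" by auto
  consider "j < m" "k < m" | "j = m" "k = m" | "j < m" "k = m" | "j = m" "k < m"
    using Suc.prems by linarith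
  then show ?case
  proof cases
    case 1
    then obtain p where "vpath p (with_proj T)" "hd p = cs ! j" "last p = cs ! k"
        "set p \<subseteq> (!) cs ` {..<m}"
      using Suc.IH[of j k] Suc.prems by auto
    then show ?thesis using mono by blast
  next
    case 2
    then show ?thesis using new(2)
      by (intro exI[of _ "[cs ! m]"]) (auto simp: vpath_def vwalk_def)
  next
    case 3
    then have par: "par m < m" "(cs ! par m, cs ! m) \<in> parcs T"
      using parent_enumerationD(1,2)[OF cs, of m] Suc.prems by auto
    obtain p where p: "vpath p (with_proj T)" "hd p = cs ! j" "last p = cs ! par m"
        "set p \<subseteq> (!) cs ` {..<m}"
      using Suc.IH[of j "par m"] 3 par Suc.prems by auto
    then have "p \<noteq> []" by (auto simp: vpath_def vwalk_def)
    then show ?thesis using p new par 3 mono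
      by (intro exI[of _ "p @ [cs ! m]"]) (auto intro!: vpath_snoc)
  next
    case 4
    then have par: "par m < m" "(cs ! m, cs ! par m) \<in> parcs T"
      using parent_enumerationD(1,2)[OF cs, of m] Suc.prems by (auto intro: pair_graph_sym[OF T])
    obtain p where p: "vpath p (with_proj T)" "hd p = cs ! par m" "last p = cs ! k"
        "set p \<subseteq> (!) cs ` {..<m}"
      using Suc.IH[of "par m" k] 4 par Suc.prems by auto
    then have "p \<noteq> []" by (auto simp: vpath_def vwalk_def)
    then show ?thesis using p new par 4 mono
      by (intro exI[of _ "cs ! m # p"]) (auto intro!: vpath_Cons)
  qed
qed simp

text \<open>
  Without such an arc, all nodes reachable from \<open>A\<close> would be in \<open>A\<close>.
\<close>

lemma connected_arc_leaving:
  assumes T: "undirected_tree T" and A: "A \<subseteq> pverts T" "A \<noteq> {}" "A \<noteq> pverts T"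
  shows "\<exists>u v. u \<in> A \<and> v \<in> pverts T - A \<and> (u, v) \<in> parcs T"
proof (rule ccontr)
  assume no: "\<not> ?thesis"
  have g: "pair_graph T" using T by (simp add: undirected_tree_def)
  obtain u v where uv: "u \<in> A" "v \<in> pverts T" "v \<notin> A" using A by auto
  have "strongly_connected (mk_symmetric (with_proj T))"
    using T by (simp add: undirected_tree_def Digraph_Component.connected_def)
  then have "u \<rightarrow>\<^sup>*\<^bsub>with_proj (mk_symmetric (with_proj T))\<^esub> v"
    using uv A by (auto simp: strongly_connected_def)
  then have "(u, v) \<in> (parcs (mk_symmetric (with_proj T)))\<^sup>*"
    by (metis reachable_def rtrancl_on_rtranclI with_proj_simps(3))
  then have "v \<in> A"
  proof (induction rule: rtrancl_induct)
    case (step y z)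
    then have "(y, z) \<in> parcs T"
      by (auto simp: parcs_mk_symmetric intro: pair_graph_sym[OF g])
    then show ?case using no step.IH pair_graph_verts[OF g] by blast
  qed (use uv in simp)
  then show False using uv by simp
qed

text \<open>
  By connectedness some new node \<open>c\<close> is adjacent to an enumerated one. It is adjacent to one only:
  two of them are joined by a path of enumerated nodes, and \<open>c\<close> would close this path to a cycle.
\<close>

lemma parent_enumeration_extend:
  assumes T: "undirected_tree T" and cs: "parent_enumeration T cs par"
    and ne: "cs \<noteq> []" "set cs \<noteq> pverts T"
  shows "\<exists>c par'. parent_enumeration T (cs @ [c]) par'"
proof -
  have g: "pair_graph T" using T by (simp add: undirected_tree_def)
  have "set cs \<subseteq> pverts T" using cs by (simp add: parent_enumeration_def)
  then obtain u c where c: "u \<in> set cs" "c \<in> pverts T - set cs" "(u, c) \<in> parcs T"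
    using connected_arc_leaving[OF T, of "set cs"] ne by auto
  then obtain k where k: "k < length cs" "cs ! k = u" by (auto simp: in_set_conv_nth)
  have unique: "j = k" if j: "j < length cs" "(cs ! j, c) \<in> parcs T" for j
  proof (rule ccontr)
    assume "j \<noteq> k"
    obtain p where p: "vpath p (with_proj T)" "hd p = cs ! j" "last p = cs ! k"
        "set p \<subseteq> set cs"
      using parent_enumeration_vpath[OF g cs order.refl, of j k] j k
      unfolding image_nth_lessThan by auto
    have "cs ! j \<noteq> cs ! k"
      using cs j k \<open>j \<noteq> k\<close> by (auto simp: parent_enumeration_def nth_eq_iff_index_eq)
    then have len: "length p \<ge> 2"
      using p(1-3) by (cases p; cases "tl p") (auto simp: vpath_def vwalk_def)
    have "undirected_cycle T (p @ [c])"
      unfolding undirected_cycle_def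
    proof (intro conjI)
      show "vpath (p @ [c]) (with_proj T)" using p c k by (intro vpath_snoc) auto
      show "3 \<le> length (p @ [c])" using len by simp
      show "(last (p @ [c]), hd (p @ [c])) \<in> parcs T"
        using p(2) len pair_graph_sym[OF g j(2)] by (cases p) auto
    qed
    then show False using T by (auto simp: undirected_tree_def)
  qed
  have "parent_enumeration T (cs @ [c]) (par(length cs := k))"
    unfolding parent_enumeration_def
  proof (intro conjI allI impI)
    fix i assume i: "i < length (cs @ [c])" "0 < i"
    show "(par(length cs := k)) i < i"
      using i k parent_enumerationD(1)[OF cs, of i] by (auto split: if_splits)
    show "((cs @ [c]) ! ((par(length cs := k)) i), (cs @ [c]) ! i) \<in> parcs T"
      using i k c parent_enumerationD(1,2)[OF cs, of i] by (auto simp: nth_append split: if_splits)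
    show "j = (par(length cs := k)) i" if "j < i" "((cs @ [c]) ! j, (cs @ [c]) ! i) \<in> parcs T" for j
      using i that unique parent_enumerationD(3)[OF cs, of i j]
      by (auto simp: nth_append split: if_splits)
  qed (use c cs in \<open>auto simp: parent_enumeration_def\<close>)
  then show ?thesis by blast
qed

lemma parent_enumeration_exists:
  assumes T: "undirected_tree T" and R: "R \<in> pverts T"
  obtains cs par where "parent_enumeration T cs par" "set cs = pverts T" "cs \<noteq> []" "cs ! 0 = R"
proof -
  have fin: "finite (pverts T)"
    using T by (auto simp: undirected_tree_def intro: pair_graph_finite)
  have "\<exists>cs par. parent_enumeration T cs par \<and> length cs = Suc m \<and> cs ! 0 = R"
    if "Suc m \<le> card (pverts T)" for m
    using that
  proof (induction m)
    case 0
    show ?case using R by (intro exI[of _ "[R]"]) (auto simp: parent_enumeration_def)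
  next
    case (Suc m)
    then obtain cs par where cs: "parent_enumeration T cs par" "length cs = Suc m" "cs ! 0 = R"
      by auto
    then have "card (set cs) = Suc m" by (auto simp: parent_enumeration_def distinct_card)
    then have "set cs \<noteq> pverts T" using Suc.prems by auto
    moreover have "cs \<noteq> []" using cs(2) by auto
    ultimately obtain c par' where "parent_enumeration T (cs @ [c]) par'"
      using parent_enumeration_extend[OF T cs(1)] by blast
    then show ?case using cs by (intro exI[of _ "cs @ [c]"] exI[of _ par']) (auto simp: nth_append)
  qed
  moreover have "card (pverts T) > 0" using R fin by (auto simp: card_gt_0_iff)
  ultimately obtain cs par where cs: "parent_enumeration T cs par" "length cs = card (pverts T)" "cs ! 0 = R"
    by (metis Suc_pred le_refl)
  then have "set cs = pverts T"
    by (metis card_subset_eq distinct_card fin parent_enumeration_def)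
  then show ?thesis using that cs R by (metis list.set(1) empty_iff)
qed

text \<open>
  Every edge belongs to its later end, so a product over the edges of the tree becomes a product
  over the positions after the root.
\<close>

lemma parent_enumeration_edges:
  assumes T: "pair_graph T" and cs: "parent_enumeration T cs par" "set cs = pverts T"
  shows "undirected_edges T = (\<lambda>i. {cs ! par i, cs ! i}) ` {1..<length cs}"
    and "inj_on (\<lambda>i. {cs ! par i, cs ! i}) {1..<length cs}"
proof -
  have d: "distinct cs" using cs by (simp add: parent_enumeration_def)
  show "undirected_edges T = (\<lambda>i. {cs ! par i, cs ! i}) ` {1..<length cs}"
  proof (intro equalityI subsetI)
    fix e assume "e \<in> undirected_edges T"
    then obtain u v where e: "e = {u, v}" "(u, v) \<in> parcs T" by (auto simp: undirected_edges_def)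
    then obtain i j where ij: "i < length cs" "j < length cs" "u = cs ! i" "v = cs ! j"
      using pair_graph_verts[OF T e(2)] cs(2) by (metis in_set_conv_nth)
    have "i \<noteq> j" using pair_graph_verts[OF T e(2)] ij by auto
    then consider "i < j" | "j < i" by linarith
    then show "e \<in> (\<lambda>i. {cs ! par i, cs ! i}) ` {1..<length cs}"
    proof cases
      case 1
      then have "i = par j" using parent_enumerationD(3)[OF cs(1), of j i] e ij by auto
      then show ?thesis using 1 e ij by (intro image_eqI[of _ _ j]) auto
    next
      case 2
      then have "j = par i"
        using parent_enumerationD(3)[OF cs(1), of i j] e ij pair_graph_sym[OF T e(2)] by auto
      then show ?thesis using 2 e ij by (intro image_eqI[of _ _ i]) auto
    qed
  next
    fix e assume "e \<in> (\<lambda>i. {cs ! par i, cs ! i}) ` {1..<length cs}"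
    then show "e \<in> undirected_edges T"
      using parent_enumerationD(2)[OF cs(1)] unfolding undirected_edges_def by (auto 0 3)
  qed
  show "inj_on (\<lambda>i. {cs ! par i, cs ! i}) {1..<length cs}"
  proof (rule inj_onI)
    fix i j assume i: "i \<in> {1..<length cs}" and j: "j \<in> {1..<length cs}"
      and eq: "{cs ! par i, cs ! i} = {cs ! par j, cs ! j}"
    have "par i < i" "par j < j" using parent_enumerationD(1)[OF cs(1)] i j by auto
    then show "i = j"
      using eq i j d by (auto simp: doubleton_eq_iff nth_eq_iff_index_eq)
  qed
qed

section \<open>Junction trees\<close>

text \<open>
  A path from the \<open>j\<close>-th clique to the parent of the \<open>i\<close>-th one, inside the earlier cliques, can be
  prolonged to the \<open>i\<close>-th clique. The prolonged path runs through the parent, which therefore contains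
  the intersection of its two ends.
\<close>

lemma junction_tree_running_intersection:
  assumes J: "junction_tree G J" and cs: "parent_enumeration J cs par"
    and i: "i < length cs" "j < i"
  shows "cs ! i \<inter> cs ! j \<subseteq> cs ! par i"
proof -
  have g: "pair_graph J" using J by (simp add: junction_tree_def undirected_tree_def)
  have par: "par i < i" "(cs ! par i, cs ! i) \<in> parcs J"
    using parent_enumerationD(1,2)[OF cs, of i] i by auto
  obtain p where p: "vpath p (with_proj J)" "hd p = cs ! j" "last p = cs ! par i"
      "set p \<subseteq> (!) cs ` {..<i}"
    using parent_enumeration_vpath[OF g cs, of i j "par i"] i par by auto
  have "cs ! i \<notin> (!) cs ` {..<i}" "cs ! i \<in> pverts J"
    using cs i by (auto simp: parent_enumeration_def nth_eq_iff_index_eq)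
  then have q: "vpath (p @ [cs ! i]) (with_proj J)"
    using p par by (intro vpath_snoc) auto
  have "p \<noteq> []" using p(1) by (auto simp: vpath_def vwalk_def)
  then have "cs ! par i \<in> set (p @ [cs ! i])" "hd (p @ [cs ! i]) = cs ! j"
    using p(2,3) last_in_set[of p] by auto
  then show ?thesis
    using J q unfolding junction_tree_def by (metis Int_commute last_snoc)
qed

lemma clique_in_maximal_clique:
  assumes "finite (pverts H)" "clique H K"
  shows "\<exists>L\<in>maximal_cliques H. K \<subseteq> L"
proof -
  have "finite {L. clique H L}"
    by (rule finite_subset[of _ "Pow (pverts H)"]) (use assms in \<open>auto simp: clique_def\<close>)
  then obtain L where "L \<in> {L. clique H L}" "K \<subseteq> L" "\<And>M. M \<in> {L. clique H L} \<Longrightarrow> L \<subseteq> M \<Longrightarrow> L = M"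
    using finite_has_maximal2[of "{L. clique H L}" K] assms(2) by auto
  then show ?thesis by (intro bexI[of _ L]) (auto simp: maximal_cliques_def)
qed

lemma junction_tree_cliques:
  assumes J: "junction_tree G J"
  shows "pverts J \<noteq> {}" and "C \<in> pverts J \<Longrightarrow> C \<subseteq> pverts G"
    and "C \<in> pverts J \<Longrightarrow> D \<in> pverts J \<Longrightarrow> C \<subseteq> D \<Longrightarrow> C = D"
    and "v \<in> pverts G \<Longrightarrow> \<exists>C\<in>pverts J. v \<in> C"
    and "(u, v) \<in> parcs G \<Longrightarrow> \<exists>C\<in>pverts J. u \<in> C \<and> v \<in> C"
    and "C \<in> pverts J \<Longrightarrow> pverts G \<noteq> {} \<Longrightarrow> C \<noteq> {}"
proof -
  obtain H where H: "chordal_completion G H" "pverts J = maximal_cliques H"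
    using J by (auto simp: junction_tree_def)
  have g: "pair_graph H" "pverts H = pverts G" "parcs G \<subseteq> parcs H"
    using H by (auto simp: chordal_completion_def)
  note fin = pair_graph_finite[OF g(1)]
  show "pverts J \<noteq> {}"
    using clique_in_maximal_clique[OF fin, of "{}"] H by (auto simp: clique_def)
  show "C \<in> pverts J \<Longrightarrow> C \<subseteq> pverts G"
    using H g by (auto simp: maximal_cliques_def clique_def)
  show "C \<in> pverts J \<Longrightarrow> D \<in> pverts J \<Longrightarrow> C \<subseteq> D \<Longrightarrow> C = D"
    using H by (auto simp: maximal_cliques_def)
  have vert: "\<exists>C\<in>pverts J. v \<in> C" if "v \<in> pverts G" for v
    using clique_in_maximal_clique[OF fin, of "{v}"] H g that by (auto simp: clique_def)
  then show "v \<in> pverts G \<Longrightarrow> \<exists>C\<in>pverts J. v \<in> C" .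
  show "\<exists>C\<in>pverts J. u \<in> C \<and> v \<in> C" if e: "(u, v) \<in> parcs G"
  proof -
    have "(u, v) \<in> parcs H" using e g by auto
    then have "clique H {u, v}"
      using pair_graph_verts[OF g(1)] by (auto simp: clique_def intro: pair_graph_sym[OF g(1)])
    then show ?thesis using clique_in_maximal_clique[OF fin, of "{u, v}"] H by auto
  qed
  show "C \<noteq> {}" if C: "C \<in> pverts J" and ne: "pverts G \<noteq> {}"
  proof -
    obtain v where "v \<in> pverts G" using ne by auto
    then obtain D where "D \<in> pverts J" "v \<in> D" using vert by auto
    then show ?thesis using C H by (auto simp: maximal_cliques_def)
  qed
qed

text \<open>
  Each clique of a parent enumeration contains a vertex that is in no earlier clique: by the running
  intersection property a clique covered by the earlier ones would be contained in its parent, and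
  maximal cliques are incomparable.
\<close>

lemma junction_tree_card_le:
  assumes J: "junction_tree G J" and ne: "pverts G \<noteq> {}" and fin: "finite (pverts G)"
  shows "card (pverts J) \<le> card (pverts G)"
proof -
  have T: "undirected_tree J" using J by (simp add: junction_tree_def)
  obtain R where "R \<in> pverts J" using junction_tree_cliques(1)[OF J] by blast
  then obtain cs par where cs: "parent_enumeration J cs par" "set cs = pverts J"
    by (rule parent_enumeration_exists[OF T])
  have d: "distinct cs" using cs by (simp add: parent_enumeration_def)
  have "m \<le> card (\<Union>j<m. cs ! j)" if "m \<le> length cs" for m
    using that
  proof (induction m)
    case (Suc m)
    let ?U = "\<Union>j<m. cs ! j"
    have in_J: "cs ! j \<in> pverts J" if "j \<le> m" for j
      unfolding cs(2)[symmetric] using Suc.prems that by (intro nth_mem) simp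
    have "\<not> cs ! m \<subseteq> ?U"
    proof
      assume sub: "cs ! m \<subseteq> ?U"
      have "cs ! m \<noteq> {}" using junction_tree_cliques(6)[OF J in_J ne] by simp
      then have "0 < m" using sub by (intro gr0I) simp
      have "cs ! m \<subseteq> cs ! par m"
      proof
        fix v assume "v \<in> cs ! m"
        then obtain j where "j < m" "v \<in> cs ! j" using sub by auto
        then show "v \<in> cs ! par m"
          using \<open>v \<in> cs ! m\<close> junction_tree_running_intersection[OF J cs(1), of m j] Suc.prems by auto
      qed
      moreover have "par m < m"
        using parent_enumerationD(1)[OF cs(1), of m] Suc.prems \<open>0 < m\<close> by simp
      ultimately have "cs ! m = cs ! par m"
        using junction_tree_cliques(3)[OF J in_J in_J] by (metis le_refl less_imp_le)
      moreover have "cs ! m \<noteq> cs ! par m"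
        using \<open>par m < m\<close> Suc.prems by (subst nth_eq_iff_index_eq[OF d]) auto
      ultimately show False by contradiction
    qed
    then have "?U \<subset> (\<Union>j<Suc m. cs ! j)" unfolding lessThan_Suc by blast
    moreover have "finite (\<Union>j<Suc m. cs ! j)"
    proof (intro finite_UN_I)
      fix j assume "j \<in> {..<Suc m}"
      then show "finite (cs ! j)"
        using finite_subset[OF junction_tree_cliques(2)[OF J in_J[of j]] fin] by simp
    qed simp
    ultimately have "card ?U < card (\<Union>j<Suc m. cs ! j)" by (rule psubset_card_mono[rotated])
    then show ?case using Suc by simp
  qed simp
  from this[of "length cs"] have "length cs \<le> card (\<Union>j<length cs. cs ! j)" by simp
  also have "\<dots> \<le> card (pverts G)"
  proof (intro card_mono fin UN_least)
    fix j assume "j \<in> {..<length cs}"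
    then have "cs ! j \<in> pverts J" unfolding cs(2)[symmetric] by simp
    then show "cs ! j \<subseteq> pverts G" by (rule junction_tree_cliques(2)[OF J])
  qed
  finally show ?thesis
    using cs(2) distinct_card[OF d] by simp
qed

text \<open>
  The side of the tree that contains \<open>i\<close> after the edge from \<open>i\<close> to its parent is cut. The guard
  \<open>i < k\<close> makes \<open>i\<close> the least element.
\<close>

inductive_set descendants :: "(nat \<Rightarrow> nat) \<Rightarrow> nat \<Rightarrow> nat set" for par i where
  self: "i \<in> descendants par i"
| child: "i < k \<Longrightarrow> par k \<in> descendants par i \<Longrightarrow> k \<in> descendants par i"

lemma descendants_ge: "k \<in> descendants par i \<Longrightarrow> i \<le> k"
  by (induction rule: descendants.induct) auto

text \<open>
  The cliques that contain a given vertex \<open>v\<close> form a connected part of the tree. If \<open>v\<close> is not in the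
  separator, this part does not use the edge from \<open>i\<close> to its parent, so all these cliques are on the
  same side of that edge as the first of them. Adjacent vertices share a clique, hence the side does
  not change along a path that avoids the separator. But the first vertex of the path is in an earlier
  clique than the \<open>i\<close>-th, and the last vertex is in the \<open>i\<close>-th, which is on the other side.
\<close>

lemma junction_tree_separated:
  assumes J: "junction_tree G J" and cs: "parent_enumeration J cs par" "set cs = pverts J"
    and i: "i < length cs" "0 < i"
  shows "separated G (\<Union>j<i. cs ! j) (cs ! i) (cs ! i \<inter> cs ! par i)"
  unfolding separated_def
proof (intro allI impI notI)
  fix p assume p: "vpath p (with_proj G) \<and> hd p \<in> (\<Union>j<i. cs ! j) \<and> last p \<in> cs ! i"
    and avoid: "set p \<inter> (cs ! i \<inter> cs ! par i) = {}"
  let ?D = "descendants par i"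
  define first where "first v = (LEAST k. k < length cs \<and> v \<in> cs ! k)" for v
  have same_side: "k \<in> ?D \<longleftrightarrow> first v \<in> ?D"
    if "k < length cs" "v \<in> cs ! k" "v \<notin> cs ! i \<inter> cs ! par i" for v k
    using that
  proof (induction k rule: less_induct)
    case (less k)
    have f: "first v < length cs" "v \<in> cs ! first v" "first v \<le> k"
      unfolding first_def
      using LeastI[of "\<lambda>k. k < length cs \<and> v \<in> cs ! k" k] Least_le[of "\<lambda>k. k < length cs \<and> v \<in> cs ! k" k]
        less.prems by auto
    show ?case
    proof (cases "k = first v")
      case False
      then have "first v < k" using f by simp
      then have par: "v \<in> cs ! par k" "par k < k"
        using junction_tree_running_intersection[OF J cs(1), of k "first v"] less.prems f
          parent_enumerationD(1)[OF cs(1), of k] by auto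
      have "k \<noteq> i" using par less.prems by auto
      then have "k \<in> ?D \<longleftrightarrow> par k \<in> ?D"
        using par(2) descendants_ge[of k par i] descendants_ge[of "par k" par i]
          descendants.simps[of k par i] by (metis less_le_trans less_imp_le not_le)
      also have "\<dots> \<longleftrightarrow> first v \<in> ?D"
        using less.IH[of "par k"] par less.prems by simp
      finally show ?thesis .
    qed simp
  qed
  have "vwalk p (with_proj G)" using p by (simp add: vpath_def)
  then have "set p \<inter> (cs ! i \<inter> cs ! par i) = {} \<longrightarrow> (first (hd p) \<in> ?D \<longleftrightarrow> first (last p) \<in> ?D)"
  proof (induction rule: vwalk_induct)
    case (Cons u v es)
    then have "(u, v) \<in> parcs G" by simp
    then obtain C where "C \<in> pverts J" "u \<in> C" "v \<in> C"
      using junction_tree_cliques(5)[OF J] by blast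
    then obtain k where k: "k < length cs" "u \<in> cs ! k" "v \<in> cs ! k"
      unfolding cs(2)[symmetric] in_set_conv_nth by blast
    show ?case
    proof
      assume avoid: "set (u # v # es) \<inter> (cs ! i \<inter> cs ! par i) = {}"
      then have "first u \<in> ?D \<longleftrightarrow> first v \<in> ?D"
        using same_side[OF k(1,2)] same_side[OF k(1,3)] by auto
      then show "first (hd (u # v # es)) \<in> ?D \<longleftrightarrow> first (last (u # v # es)) \<in> ?D"
        using Cons.IH avoid by simp
    qed
  qed simp
  then have ends: "first (hd p) \<in> ?D \<longleftrightarrow> first (last p) \<in> ?D" using avoid by simp
  have "p \<noteq> []" using p by (auto simp: vpath_def vwalk_def)
  then have in_p: "hd p \<in> set p" "last p \<in> set p" by auto
  obtain j where j: "j < i" "hd p \<in> cs ! j" using p by auto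
  then have "first (hd p) \<notin> ?D"
    using same_side[of j "hd p"] i in_p avoid descendants_ge[of j par i] by auto
  moreover have "first (last p) \<in> ?D"
    using same_side[of i "last p"] i in_p avoid p by (auto intro: descendants.self)
  ultimately show False using ends by simp
qed

section \<open>Polynomials of bounded degree in each variable\<close>

lemma coordwise_polys_sum:
  assumes "\<And>i. i \<in> A \<Longrightarrow> p i \<in> coordwise_polys D n"
  shows "(\<lambda>x. \<Sum>i\<in>A. a i * p i x) \<in> coordwise_polys D n"
proof -
  let ?m = "\<lambda>m x. \<Prod>k\<in>D. x k ^ m k"
  have "\<forall>i\<in>A. \<exists>c. p i = (\<lambda>x. \<Sum>m\<in>D \<rightarrow>\<^sub>E {..n}. c m * ?m m x)"
    using assms by (simp add: coordwise_polys_def)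
  from bchoice[OF this] obtain c
    where c: "\<And>i. i \<in> A \<Longrightarrow> p i = (\<lambda>x. \<Sum>m\<in>D \<rightarrow>\<^sub>E {..n}. c i m * ?m m x)"
    by auto
  have "(\<lambda>x. \<Sum>i\<in>A. a i * p i x) = (\<lambda>x. \<Sum>m\<in>D \<rightarrow>\<^sub>E {..n}. (\<Sum>i\<in>A. a i * c i m) * ?m m x)"
  proof (rule ext)
    fix x
    have "(\<Sum>i\<in>A. a i * p i x) = (\<Sum>i\<in>A. \<Sum>m\<in>D \<rightarrow>\<^sub>E {..n}. a i * c i m * ?m m x)"
      by (rule sum.cong) (simp_all add: c sum_distrib_left mult.assoc)
    also have "\<dots> = (\<Sum>m\<in>D \<rightarrow>\<^sub>E {..n}. \<Sum>i\<in>A. a i * c i m * ?m m x)" by (rule sum.swap)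
    finally show "(\<Sum>i\<in>A. a i * p i x) = (\<Sum>m\<in>D \<rightarrow>\<^sub>E {..n}. (\<Sum>i\<in>A. a i * c i m) * ?m m x)"
      by (simp add: sum_distrib_right)
  qed
  then show ?thesis
    unfolding coordwise_polys_def mem_Collect_eq by (rule exI[of _ "\<lambda>m. \<Sum>i\<in>A. a i * c i m"])
qed

lemma coordwise_polys_add:
  assumes "p \<in> coordwise_polys D n" "q \<in> coordwise_polys D n"
  shows "(\<lambda>x. p x + q x) \<in> coordwise_polys D n"
  using coordwise_polys_sum[of "{True, False}" "\<lambda>b. if b then p else q" D n "\<lambda>_. 1"] assms by simp

lemma coordwise_polys_scale:
  assumes "p \<in> coordwise_polys D n"
  shows "(\<lambda>x. a * p x) \<in> coordwise_polys D n"
  using coordwise_polys_sum[of "{()}" "\<lambda>_. p" D n "\<lambda>_. a"] assms by simp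

lemma coordwise_polys_monomial:
  assumes "finite D" "\<And>k. k \<in> D \<Longrightarrow> m k \<le> n"
  shows "(\<lambda>x. \<Prod>k\<in>D. x k ^ m k) \<in> coordwise_polys D n"
proof -
  let ?e = "restrict m D"
  have e: "?e \<in> D \<rightarrow>\<^sub>E {..n}" using assms(2) by auto
  have fin: "finite (D \<rightarrow>\<^sub>E {..n})" using assms(1) by (intro finite_PiE) auto
  have "(\<lambda>x :: nat \<Rightarrow> real. \<Prod>k\<in>D. x k ^ m k) = (\<lambda>x. \<Sum>m'\<in>D \<rightarrow>\<^sub>E {..n}. (if m' = ?e then 1 else 0) * (\<Prod>k\<in>D. x k ^ m' k))"
  proof (rule ext)
    fix x :: "nat \<Rightarrow> real"
    have "(\<Sum>m'\<in>D \<rightarrow>\<^sub>E {..n}. (if m' = ?e then 1 else 0) * (\<Prod>k\<in>D. x k ^ m' k)) =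
        (\<Sum>m'\<in>D \<rightarrow>\<^sub>E {..n}. if m' = ?e then (\<Prod>k\<in>D. x k ^ m' k) else 0)"
      by (intro sum.cong) auto
    also have "\<dots> = (\<Prod>k\<in>D. x k ^ ?e k)" using e fin by simp
    also have "\<dots> = (\<Prod>k\<in>D. x k ^ m k)" by (intro prod.cong) auto
    finally show "(\<Prod>k\<in>D. x k ^ m k) = (\<Sum>m'\<in>D \<rightarrow>\<^sub>E {..n}. (if m' = ?e then 1 else 0) * (\<Prod>k\<in>D. x k ^ m' k))"
      by (rule sym)
  qed
  then show ?thesis
    unfolding coordwise_polys_def mem_Collect_eq by (rule exI[of _ "\<lambda>m'. if m' = ?e then 1 else 0"])
qed

lemma coordwise_polys_const:
  assumes "finite D"
  shows "(\<lambda>_. a) \<in> coordwise_polys D n"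
  using coordwise_polys_scale[OF coordwise_polys_monomial[OF assms, of "\<lambda>_. 0"]] by simp

lemma coordwise_polys_mono:
  assumes "finite C" "D \<subseteq> C" "m \<le> n"
  shows "coordwise_polys D m \<subseteq> coordwise_polys C n"
proof
  fix p assume "p \<in> coordwise_polys D m"
  then obtain c where p: "p = (\<lambda>x. \<Sum>e\<in>D \<rightarrow>\<^sub>E {..m}. c e * (\<Prod>k\<in>D. x k ^ e k))"
    by (auto simp: coordwise_polys_def)
  have mon: "(\<lambda>x. \<Prod>k\<in>D. x k ^ e k) \<in> coordwise_polys C n" if "e \<in> D \<rightarrow>\<^sub>E {..m}" for e
  proof -
    have "(\<lambda>x. \<Prod>k\<in>C. x k ^ (if k \<in> D then e k else 0)) \<in> coordwise_polys C n"
    proof (rule coordwise_polys_monomial[OF assms(1)])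
      fix k show "(if k \<in> D then e k else 0) \<le> n"
        using that assms(3) by (auto simp: PiE_def Pi_def)
    qed
    moreover have "(\<Prod>k\<in>C. x k ^ (if k \<in> D then e k else 0)) = (\<Prod>k\<in>D. x k ^ e k)" for x :: "nat \<Rightarrow> real"
      using assms by (intro prod.mono_neutral_cong_right) auto
    ultimately show ?thesis by simp
  qed
  show "p \<in> coordwise_polys C n" unfolding p by (intro coordwise_polys_sum mon)
qed

lemma coordwise_polys_coord:
  assumes "finite D" "k \<in> D"
  shows "(\<lambda>x. x k) \<in> coordwise_polys D 1"
proof -
  have "(\<lambda>x. \<Prod>j\<in>{k}. x j ^ 1) \<in> coordwise_polys {k} 1"
    by (intro coordwise_polys_monomial) auto
  then show ?thesis using coordwise_polys_mono[of D "{k}" 1 1] assms by auto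
qed

lemma coordwise_polys_mult:
  assumes D: "finite D" and p: "p \<in> coordwise_polys D m" and q: "q \<in> coordwise_polys D n"
  shows "(\<lambda>x. p x * q x) \<in> coordwise_polys D (m + n)"
proof -
  obtain b where b: "p = (\<lambda>x. \<Sum>e\<in>D \<rightarrow>\<^sub>E {..m}. b e * (\<Prod>k\<in>D. x k ^ e k))"
    using p by (auto simp: coordwise_polys_def)
  obtain c where c: "q = (\<lambda>x. \<Sum>e\<in>D \<rightarrow>\<^sub>E {..n}. c e * (\<Prod>k\<in>D. x k ^ e k))"
    using q by (auto simp: coordwise_polys_def)
  have mon: "(\<lambda>x. \<Prod>k\<in>D. x k ^ (e k + e' k)) \<in> coordwise_polys D (m + n)"
    if "e \<in> D \<rightarrow>\<^sub>E {..m}" "e' \<in> D \<rightarrow>\<^sub>E {..n}" for e e'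
    using that by (intro coordwise_polys_monomial[OF D] add_mono) (auto simp: PiE_def Pi_def)
  have "(\<lambda>x. \<Sum>e\<in>D \<rightarrow>\<^sub>E {..m}. b e * (\<Sum>e'\<in>D \<rightarrow>\<^sub>E {..n}. c e' * (\<Prod>k\<in>D. x k ^ (e k + e' k))))
      \<in> coordwise_polys D (m + n)"
    by (intro coordwise_polys_sum mon)
  moreover have "(\<Sum>e\<in>D \<rightarrow>\<^sub>E {..m}. b e * (\<Sum>e'\<in>D \<rightarrow>\<^sub>E {..n}. c e' * (\<Prod>k\<in>D. x k ^ (e k + e' k)))) = p x * q x" for x
    unfolding b c sum_product
    by (simp only: sum_distrib_left power_add prod.distrib mult_ac)
  ultimately show ?thesis by simp
qed

lemma coordwise_polys_power:
  assumes D: "finite D" and p: "p \<in> coordwise_polys D n"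
  shows "(\<lambda>x. p x ^ m) \<in> coordwise_polys D (m * n)"
proof (induction m)
  case (Suc m)
  then show ?case using coordwise_polys_mult[OF D p Suc] by simp
qed (use coordwise_polys_const[OF D] in simp)

lemma coordwise_polys_cong:
  assumes p: "p \<in> coordwise_polys D n" and xy: "\<And>k. k \<in> D \<Longrightarrow> x k = y k"
  shows "p x = p y"
proof -
  obtain c where c: "p = (\<lambda>x. \<Sum>e\<in>D \<rightarrow>\<^sub>E {..n}. c e * (\<Prod>k\<in>D. x k ^ e k))"
    using p by (auto simp: coordwise_polys_def)
  have "(\<Prod>k\<in>D. x k ^ e k) = (\<Prod>k\<in>D. y k ^ e k)" for e :: "nat \<Rightarrow> nat"
    by (intro prod.cong) (auto simp: xy)
  then show ?thesis by (simp add: c)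
qed

lemma coordwise_polys_measurable:
  assumes p: "p \<in> coordwise_polys D n" and D: "D \<subseteq> I"
  shows "p \<in> borel_measurable (lebesgue_on_coords I)"
proof -
  obtain c where c: "p = (\<lambda>x. \<Sum>e\<in>D \<rightarrow>\<^sub>E {..n}. c e * (\<Prod>k\<in>D. x k ^ e k))"
    using p by (auto simp: coordwise_polys_def)
  have [measurable]: "(\<lambda>x. x k) \<in> borel_measurable (lebesgue_on_coords I)" if "k \<in> D" for k
    using measurable_component_singleton[of k I "\<lambda>_. lborel"] that D by auto
  show ?thesis unfolding c by measurable
qed

lemma coordwise_polys_bounded:
  assumes p: "p \<in> coordwise_polys D n"
  shows "\<exists>M. \<forall>x. (\<forall>k\<in>D. \<bar>x k\<bar> \<le> R) \<longrightarrow> \<bar>p x\<bar> \<le> M"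
proof -
  obtain c where c: "p = (\<lambda>x. \<Sum>e\<in>D \<rightarrow>\<^sub>E {..n}. c e * (\<Prod>k\<in>D. x k ^ e k))"
    using p by (auto simp: coordwise_polys_def)
  have "\<bar>p x\<bar> \<le> (\<Sum>e\<in>D \<rightarrow>\<^sub>E {..n}. \<bar>c e\<bar> * (\<Prod>k\<in>D. R ^ e k))" if R: "\<forall>k\<in>D. \<bar>x k\<bar> \<le> R" for x
  proof -
    have "\<bar>p x\<bar> \<le> (\<Sum>e\<in>D \<rightarrow>\<^sub>E {..n}. \<bar>c e * (\<Prod>k\<in>D. x k ^ e k)\<bar>)"
      unfolding c by (rule sum_abs)
    also have "\<dots> \<le> (\<Sum>e\<in>D \<rightarrow>\<^sub>E {..n}. \<bar>c e\<bar> * (\<Prod>k\<in>D. R ^ e k))"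
      unfolding abs_mult abs_prod power_abs using R
      by (intro sum_mono mult_left_mono prod_mono conjI power_mono) auto
    finally show ?thesis .
  qed
  then show ?thesis by blast
qed

text \<open>
  Collecting the powers of one variable allows induction on the set of variables.
\<close>

lemma coordwise_polys_insert:
  assumes D: "finite D" "k \<notin> D" and p: "p \<in> coordwise_polys (insert k D) n"
  obtains r where "\<And>j. r j \<in> coordwise_polys D n" "p = (\<lambda>x. \<Sum>j\<le>n. x k ^ j * r j x)"
proof -
  obtain c where c: "p = (\<lambda>x. \<Sum>e\<in>insert k D \<rightarrow>\<^sub>E {..n}. c e * (\<Prod>i\<in>insert k D. x i ^ e i))"
    using p by (auto simp: coordwise_polys_def)
  define r where "r j = (\<lambda>x. \<Sum>e\<in>D \<rightarrow>\<^sub>E {..n}. c (e(k := j)) * (\<Prod>i\<in>D. x i ^ e i))" for j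
  have "p x = (\<Sum>j\<le>n. x k ^ j * r j x)" for x
  proof -
    have "p x = (\<Sum>(j, e)\<in>{..n} \<times> (D \<rightarrow>\<^sub>E {..n}).
        c (e(k := j)) * (\<Prod>i\<in>insert k D. x i ^ (e(k := j)) i))"
      unfolding c PiE_insert_eq
      by (subst sum.reindex[OF inj_combinator[OF D(2)]]) (simp add: case_prod_unfold)
    also have "\<dots> = (\<Sum>(j, e)\<in>{..n} \<times> (D \<rightarrow>\<^sub>E {..n}). x k ^ j * (c (e(k := j)) * (\<Prod>i\<in>D. x i ^ e i)))"
    proof (intro sum.cong refl, clarify)
      fix j e
      have "(\<Prod>i\<in>D. x i ^ (e(k := j)) i) = (\<Prod>i\<in>D. x i ^ e i)"
        using D(2) by (intro prod.cong) auto
      then show "c (e(k := j)) * (\<Prod>i\<in>insert k D. x i ^ (e(k := j)) i) =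
          x k ^ j * (c (e(k := j)) * (\<Prod>i\<in>D. x i ^ e i))"
        using D by simp
    qed
    also have "\<dots> = (\<Sum>j\<le>n. x k ^ j * r j x)"
      by (simp add: r_def sum.cartesian_product[symmetric] sum_distrib_left)
    finally show ?thesis .
  qed
  moreover have "r j \<in> coordwise_polys D n" for j
    unfolding r_def coordwise_polys_def mem_Collect_eq by (rule exI[of _ "\<lambda>e. c (e(k := j))"]) simp
  ultimately show ?thesis using that by blast
qed

text \<open>
  Along one variable, with the others fixed, the polynomial has infinitely many roots, so its
  coefficients vanish on a box in the other variables.
\<close>

lemma coordwise_polys_eq_0:
  assumes "finite D" "p \<in> coordwise_polys D n" "\<epsilon> > 0"
    and "\<And>x. (\<And>k. k \<in> D \<Longrightarrow> \<bar>x k - z k\<bar> \<le> \<epsilon>) \<Longrightarrow> p x = 0"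
  shows "p = (\<lambda>_. 0)"
  using assms(1,2,4)
proof (induction D arbitrary: p)
  case empty
  then show ?case by auto
next
  case (insert k D)
  obtain r where r: "\<And>j. r j \<in> coordwise_polys D n" "p = (\<lambda>x. \<Sum>j\<le>n. x k ^ j * r j x)"
    using coordwise_polys_insert[OF insert.hyps insert.prems(1)] by blast
  have "r j = (\<lambda>_. 0)" if "j \<le> n" for j
  proof (rule insert.IH[OF r(1)])
    fix x assume x: "\<And>i. i \<in> D \<Longrightarrow> \<bar>x i - z i\<bar> \<le> \<epsilon>"
    have "{z k - \<epsilon>..z k + \<epsilon>} \<subseteq> {t. (\<Sum>j\<le>n. r j x * t ^ j) = 0}"
    proof
      fix t assume t: "t \<in> {z k - \<epsilon>..z k + \<epsilon>}"
      have "p (x(k := t)) = 0"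
        using x t by (intro insert.prems(2)) auto
      moreover have "r j (x(k := t)) = r j x" for j
        using insert.hyps(2) by (intro coordwise_polys_cong[OF r(1)]) auto
      ultimately show "t \<in> {t. (\<Sum>j\<le>n. r j x * t ^ j) = 0}"
        by (simp add: r(2) mult.commute)
    qed
    moreover have "infinite {z k - \<epsilon>..z k + \<epsilon>}" using \<open>\<epsilon> > 0\<close> by (simp add: infinite_Icc)
    ultimately have "infinite {t. (\<Sum>j\<le>n. r j x * t ^ j) = 0}" using finite_subset by blast
    then show "r j x = 0" using that polyfun_finite_roots[of "\<lambda>j. r j x" n] by auto
  qed
  then show ?case by (simp add: r(2))
qed

section \<open>Orthonormal bases and the Christoffel polynomial\<close>

text \<open>
  The space \<open>V\<close> may be infinite-dimensional; only finitely many vectors \<open>F\<close> are orthonormalised. A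
  remainder of norm 0 is the zero function, because the inner product is definite on \<open>V\<close>; any other
  remainder can be normalised.
\<close>

lemma gram_schmidt:
  fixes \<nu> :: "'a measure" and V F :: "('a \<Rightarrow> real) set"
  assumes add: "\<And>p q. p \<in> V \<Longrightarrow> q \<in> V \<Longrightarrow> (\<lambda>x. p x + q x) \<in> V"
    and scale: "\<And>a p. p \<in> V \<Longrightarrow> (\<lambda>x. a * p x) \<in> V"
    and zero: "(\<lambda>_. 0) \<in> V"
    and int: "\<And>p q. p \<in> V \<Longrightarrow> q \<in> V \<Longrightarrow> integrable \<nu> (\<lambda>x. p x * q x)"
    and pos_def: "\<And>p. p \<in> V \<Longrightarrow> (\<integral>x. p x * p x \<partial>\<nu>) = 0 \<Longrightarrow> p = (\<lambda>_. 0)"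
    and F: "finite F" "F \<subseteq> V"
  shows "\<exists>P. finite P \<and> P \<subseteq> V \<and>
      (\<forall>p\<in>P. \<forall>q\<in>P. (\<integral>x. p x * q x \<partial>\<nu>) = (if p = q then 1 else 0)) \<and>
      (\<forall>g\<in>F. \<exists>c. g = (\<lambda>x. \<Sum>p\<in>P. c p * p x))"
  using F
proof (induction F rule: finite_induct)
  case empty
  show ?case by (intro exI[of _ "{}"]) simp
next
  case (insert g F)
  have "F \<subseteq> V" using insert.prems by simp
  from insert.IH[OF this] obtain P where P0: "finite P" "P \<subseteq> V"
    "\<forall>p\<in>P. \<forall>q\<in>P. (\<integral>x. p x * q x \<partial>\<nu>) = (if p = q then 1 else 0)"
    "\<forall>f\<in>F. \<exists>c. f = (\<lambda>x. \<Sum>p\<in>P. c p * p x)"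
    by (elim exE conjE) (rule that)
  note P = P0(1,2) P0(3)[rule_format] P0(4)[rule_format]
  have g: "g \<in> V" using insert.prems by simp
  have sum_V: "(\<lambda>x. \<Sum>p\<in>Q. c p * p x) \<in> V" if "finite Q" "Q \<subseteq> V" for Q c
    using that
  proof (induction Q rule: finite_induct)
    case (insert q Q)
    then have "(\<lambda>x. c q * q x + (\<Sum>p\<in>Q. c p * p x)) \<in> V" by (intro add scale) auto
    then show ?case using insert.hyps by simp
  qed (simp add: zero)
  define a where "a p = (\<integral>x. g x * p x \<partial>\<nu>)" for p
  define h where "h x = g x + (- 1) * (\<Sum>p\<in>P. a p * p x)" for x
  have h: "h \<in> V" unfolding h_def using P(1,2) g by (intro add scale sum_V)
  have g_eq: "g x = h x + (\<Sum>p\<in>P. a p * p x)" for x by (simp add: h_def)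
  have orth: "(\<integral>x. h x * q x \<partial>\<nu>) = 0" if q: "q \<in> P" for q
  proof -
    have qV: "q \<in> V" using q P(2) by auto
    have "(\<integral>x. h x * q x \<partial>\<nu>) = (\<integral>x. g x * q x - (\<Sum>p\<in>P. a p * (p x * q x)) \<partial>\<nu>)"
      by (intro Bochner_Integration.integral_cong refl)
         (simp add: h_def left_diff_distrib sum_distrib_right mult.assoc)
    also have "\<dots> = a q - (\<integral>x. (\<Sum>p\<in>P. a p * (p x * q x)) \<partial>\<nu>)"
      unfolding a_def[of q]
      by (intro Bochner_Integration.integral_diff int g qV Bochner_Integration.integrable_sum integrable_mult_right)
         (use P(2) in auto)
    also have "(\<integral>x. (\<Sum>p\<in>P. a p * (p x * q x)) \<partial>\<nu>) = (\<Sum>p\<in>P. a p * (\<integral>x. p x * q x \<partial>\<nu>))"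
    proof (subst Bochner_Integration.integral_sum)
      fix p assume "p \<in> P"
      then show "integrable \<nu> (\<lambda>x. a p * (p x * q x))"
        using P(2) by (intro integrable_mult_right int qV) auto
    qed simp
    also have "(\<Sum>p\<in>P. a p * (\<integral>x. p x * q x \<partial>\<nu>)) = (\<Sum>p\<in>P. if p = q then a p else 0)"
      by (intro sum.cong refl) (simp add: P(3) q)
    also have "a q - \<dots> = 0" using q P(1) by simp
    finally show ?thesis .
  qed
  show ?case
  proof (cases "h = (\<lambda>_. 0)")
    case True
    then have "g = (\<lambda>x. \<Sum>p\<in>P. a p * p x)" using g_eq by auto
    then have "\<forall>f\<in>insert g F. \<exists>c. f = (\<lambda>x. \<Sum>p\<in>P. c p * p x)" using P(4) by auto
    then show ?thesis using P(1-3) by (intro exI[of _ P]) simp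
  next
    case False
    define N where "N = (\<integral>x. h x * h x \<partial>\<nu>)"
    have "N \<noteq> 0" using pos_def[OF h] False by (auto simp: N_def)
    moreover have "N \<ge> 0" unfolding N_def by (intro Bochner_Integration.integral_nonneg) simp
    ultimately have N: "N > 0" by simp
    define e where "e x = 1 / sqrt N * h x" for x
    have e: "e \<in> V" unfolding e_def by (intro scale h)
    have eq_int: "(\<integral>x. e x * q x \<partial>\<nu>) = 1 / sqrt N * (\<integral>x. h x * q x \<partial>\<nu>)" for q
      by (simp add: e_def mult.assoc)
    have e_orth: "(\<integral>x. e x * q x \<partial>\<nu>) = 0" if "q \<in> P" for q
      using orth[OF that] by (simp add: eq_int)
    have "(\<integral>x. e x * e x \<partial>\<nu>) = 1 / sqrt N * (\<integral>x. e x * h x \<partial>\<nu>)"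
      unfolding eq_int[of e] by (simp only: mult.commute)
    also have "\<dots> = 1 / sqrt N * (1 / sqrt N * N)" using eq_int[of h] unfolding N_def by simp
    also have "\<dots> = 1" using N by (simp add: real_div_sqrt)
    finally have e_norm: "(\<integral>x. e x * e x \<partial>\<nu>) = 1" .
    have "e \<notin> P" using e_orth e_norm by force
    have rep: "(\<lambda>x. s * e x + (\<Sum>p\<in>P. c p * p x)) =
        (\<lambda>x. \<Sum>p\<in>insert e P. (c(e := s)) p * p x)" for c s
    proof (rule ext)
      fix x
      have "(\<Sum>p\<in>P. (c(e := s)) p * p x) = (\<Sum>p\<in>P. c p * p x)"
        using \<open>e \<notin> P\<close> by (intro sum.cong) auto
      then show "s * e x + (\<Sum>p\<in>P. c p * p x) = (\<Sum>p\<in>insert e P. (c(e := s)) p * p x)"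
        using P(1) \<open>e \<notin> P\<close> by simp
    qed
    have span: "\<exists>c. f = (\<lambda>x. \<Sum>p\<in>insert e P. c p * p x)" if "f \<in> insert g F" for f
    proof (cases "f = g")
      case True
      have "f = (\<lambda>x. sqrt N * e x + (\<Sum>p\<in>P. a p * p x))"
        using N True by (auto simp: g_eq e_def)
      then show ?thesis unfolding rep by (rule exI[of _ "a(e := sqrt N)"])
    next
      case False
      then obtain c where "f = (\<lambda>x. \<Sum>p\<in>P. c p * p x)" using P(4) \<open>f \<in> insert g F\<close> by blast
      then have "f = (\<lambda>x. 0 * e x + (\<Sum>p\<in>P. c p * p x))" by simp
      then show ?thesis unfolding rep by (rule exI[of _ "c(e := 0)"])
    qed
    have "\<forall>p\<in>insert e P. \<forall>q\<in>insert e P. (\<integral>x. p x * q x \<partial>\<nu>) = (if p = q then 1 else 0)"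
    proof (intro ballI)
      fix p q assume "p \<in> insert e P" "q \<in> insert e P"
      then consider "p = e" "q = e" | "p = e" "q \<in> P" | "p \<in> P" "q = e" | "p \<in> P" "q \<in> P" by auto
      then show "(\<integral>x. p x * q x \<partial>\<nu>) = (if p = q then 1 else 0)"
      proof cases
        case 2
        then show ?thesis using e_orth[of q] \<open>e \<notin> P\<close> by auto
      next
        case 3
        then have "(\<integral>x. p x * e x \<partial>\<nu>) = 0" using e_orth[of p] by (subst mult.commute) simp
        then show ?thesis using 3 \<open>e \<notin> P\<close> by auto
      qed (simp_all add: e_norm P(3))
    qed
    then show ?thesis using P(1,2) e span by (intro exI[of _ "insert e P"]) simp
  qed
qed

text \<open>
  This is what makes an orthonormal basis exist, so that the choice in the definition of the
  Christoffel polynomial has the intended meaning.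
\<close>

definition definite_on_polys :: "nat set \<Rightarrow> nat \<Rightarrow> (nat \<Rightarrow> real) measure \<Rightarrow> bool" where
  "definite_on_polys D n \<nu> \<longleftrightarrow>
     (\<forall>p\<in>coordwise_polys D n. \<forall>q\<in>coordwise_polys D n. integrable \<nu> (\<lambda>x. p x * q x)) \<and>
     (\<forall>p\<in>coordwise_polys D n. (\<integral>x. p x * p x \<partial>\<nu>) = 0 \<longrightarrow> p = (\<lambda>_. 0))"

lemma orthonormal_poly_basis_exists:
  assumes D: "finite D" and \<nu>: "definite_on_polys D n \<nu>"
  shows "\<exists>P. orthonormal_poly_basis D n \<nu> P"
proof -
  define mon where "mon m x = (\<Prod>k\<in>D. x k ^ m k)" for m :: "nat \<Rightarrow> nat" and x :: "nat \<Rightarrow> real"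
  define E where "E = D \<rightarrow>\<^sub>E {..n}"
  have fin: "finite E" unfolding E_def using D by (intro finite_PiE) auto
  have mon: "mon m \<in> coordwise_polys D n" if "m \<in> E" for m
    unfolding mon_def using that by (intro coordwise_polys_monomial[OF D]) (auto simp: E_def)
  have "mon ` E \<subseteq> coordwise_polys D n" using mon by auto
  have int: "integrable \<nu> (\<lambda>x. p x * q x)" if "p \<in> coordwise_polys D n" "q \<in> coordwise_polys D n" for p q
    using \<nu> that by (simp add: definite_on_polys_def)
  have pos_def: "p = (\<lambda>_. 0)" if "p \<in> coordwise_polys D n" "(\<integral>x. p x * p x \<partial>\<nu>) = 0" for p
    using \<nu> that by (simp add: definite_on_polys_def)
  have "\<exists>P. finite P \<and> P \<subseteq> coordwise_polys D n \<and>
      (\<forall>p\<in>P. \<forall>q\<in>P. (\<integral>x. p x * q x \<partial>\<nu>) = (if p = q then 1 else 0)) \<and>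
      (\<forall>g\<in>mon ` E. \<exists>c. g = (\<lambda>x. \<Sum>p\<in>P. c p * p x))"
    by (rule gram_schmidt)
       (assumption | rule coordwise_polys_add coordwise_polys_scale coordwise_polys_const[OF D] int pos_def
          finite_imageI fin \<open>mon ` E \<subseteq> coordwise_polys D n\<close>)+
  then obtain P where P: "finite P" "P \<subseteq> coordwise_polys D n"
    "\<forall>p\<in>P. \<forall>q\<in>P. (\<integral>x. p x * q x \<partial>\<nu>) = (if p = q then 1 else 0)"
    "\<forall>g\<in>mon ` E. \<exists>c. g = (\<lambda>x. \<Sum>p\<in>P. c p * p x)"
    by (elim exE conjE) (rule that)
  have "\<forall>m\<in>E. \<exists>c. mon m = (\<lambda>x. \<Sum>p\<in>P. c p * p x)" using P(4) by blast
  from bchoice[OF this] obtain c where c: "\<And>m. m \<in> E \<Longrightarrow> mon m = (\<lambda>x. \<Sum>p\<in>P. c m p * p x)" by auto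
  have span: "\<exists>b. q = (\<lambda>x. \<Sum>p\<in>P. b p * p x)" if q: "q \<in> coordwise_polys D n" for q
  proof -
    obtain a where "q = (\<lambda>x. \<Sum>m\<in>D \<rightarrow>\<^sub>E {..n}. a m * (\<Prod>k\<in>D. x k ^ m k))"
      using q by (auto simp: coordwise_polys_def)
    then have a: "q = (\<lambda>x. \<Sum>m\<in>E. a m * mon m x)" by (simp add: mon_def E_def)
    have "q = (\<lambda>x. \<Sum>p\<in>P. (\<Sum>m\<in>E. a m * c m p) * p x)"
    proof (rule ext)
      fix x
      have "q x = (\<Sum>m\<in>E. \<Sum>p\<in>P. a m * c m p * p x)"
        unfolding a by (intro sum.cong refl) (simp add: c sum_distrib_left mult.assoc)
      also have "\<dots> = (\<Sum>p\<in>P. \<Sum>m\<in>E. a m * c m p * p x)" by (rule sum.swap)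
      finally show "q x = (\<Sum>p\<in>P. (\<Sum>m\<in>E. a m * c m p) * p x)" by (simp add: sum_distrib_right)
    qed
    then show ?thesis by (rule exI[of _ "\<lambda>p. \<Sum>m\<in>E. a m * c m p"])
  qed
  have "orthonormal_poly_basis D n \<nu> P"
    unfolding orthonormal_poly_basis_def by (intro conjI ballI P(1,2) P(3)[rule_format] span)
  then show ?thesis by blast
qed

lemma orthonormal_poly_basis_span:
  assumes "orthonormal_poly_basis D n \<nu> P" "q \<in> coordwise_polys D n"
  shows "\<exists>c. q = (\<lambda>x. \<Sum>p\<in>P. c p * p x)"
  using assms unfolding orthonormal_poly_basis_def by (elim conjE) (erule bspec)

lemma christoffel_poly_eq:
  assumes "finite D" "definite_on_polys D n \<nu>"
  obtains P where "orthonormal_poly_basis D n \<nu> P"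
    "\<And>z. christoffel_poly D n \<nu> z = (\<Sum>p\<in>P. (p z)\<^sup>2)"
proof
  let ?P = "SOME P. orthonormal_poly_basis D n \<nu> P"
  show "orthonormal_poly_basis D n \<nu> ?P"
    using orthonormal_poly_basis_exists[OF assms] by (rule someI_ex)
  show "christoffel_poly D n \<nu> z = (\<Sum>p\<in>?P. (p z)\<^sup>2)" for z
    by (simp add: christoffel_poly_def)
qed

lemma integral_square_expansion:
  assumes \<nu>: "definite_on_polys D n \<nu>" and P: "orthonormal_poly_basis D n \<nu> P"
  shows "(\<integral>x. (\<Sum>p\<in>P. c p * p x)\<^sup>2 \<partial>\<nu>) = (\<Sum>p\<in>P. (c p)\<^sup>2)"
proof -
  have int: "integrable \<nu> (\<lambda>x. p x * q x)" if "p \<in> P" "q \<in> P" for p q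
    using that \<nu> P unfolding definite_on_polys_def orthonormal_poly_basis_def by (simp add: subset_iff)
  have "(\<integral>x. (\<Sum>p\<in>P. c p * p x)\<^sup>2 \<partial>\<nu>) = (\<integral>x. (\<Sum>p\<in>P. \<Sum>q\<in>P. (c p * c q) * (p x * q x)) \<partial>\<nu>)"
    by (intro Bochner_Integration.integral_cong refl) (simp add: power2_eq_square sum_product mult_ac)
  also have "\<dots> = (\<Sum>p\<in>P. \<Sum>q\<in>P. (c p * c q) * (\<integral>x. p x * q x \<partial>\<nu>))"
  proof (subst Bochner_Integration.integral_sum)
    fix p assume "p \<in> P"
    then show "integrable \<nu> (\<lambda>x. \<Sum>q\<in>P. (c p * c q) * (p x * q x))"
      by (intro Bochner_Integration.integrable_sum integrable_mult_right int)
  next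
    show "(\<Sum>p\<in>P. \<integral>x. (\<Sum>q\<in>P. (c p * c q) * (p x * q x)) \<partial>\<nu>) =
        (\<Sum>p\<in>P. \<Sum>q\<in>P. (c p * c q) * (\<integral>x. p x * q x \<partial>\<nu>))"
    proof (intro sum.cong refl, subst Bochner_Integration.integral_sum)
      fix p q assume "p \<in> P" "q \<in> P"
      then show "integrable \<nu> (\<lambda>x. (c p * c q) * (p x * q x))"
        by (intro integrable_mult_right int)
    qed simp
  qed
  also have "\<dots> = (\<Sum>p\<in>P. \<Sum>q\<in>P. if p = q then c p * c q else 0)"
    using P by (intro sum.cong refl) (auto simp: orthonormal_poly_basis_def)
  also have "\<dots> = (\<Sum>p\<in>P. (c p)\<^sup>2)"
    using P by (simp add: orthonormal_poly_basis_def power2_eq_square)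
  finally show ?thesis .
qed

text \<open>
  Cauchy-Schwarz for the coordinates of \<open>q\<close> in an orthonormal basis.
\<close>

lemma christoffel_poly_lower:
  assumes D: "finite D" and \<nu>: "definite_on_polys D n \<nu>" and q: "q \<in> coordwise_polys D n"
  shows "(q z)\<^sup>2 \<le> christoffel_poly D n \<nu> z * (\<integral>x. (q x)\<^sup>2 \<partial>\<nu>)"
proof -
  obtain P where P: "orthonormal_poly_basis D n \<nu> P" "christoffel_poly D n \<nu> z = (\<Sum>p\<in>P. (p z)\<^sup>2)"
    using christoffel_poly_eq[OF D \<nu>] by metis
  from orthonormal_poly_basis_span[OF P(1) q] obtain c where c: "q = (\<lambda>x. \<Sum>p\<in>P. c p * p x)"
    by (elim exE) (rule that)
  have "(q z)\<^sup>2 \<le> (\<Sum>p\<in>P. (c p)\<^sup>2) * (\<Sum>p\<in>P. (p z)\<^sup>2)"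
    unfolding c using Cauchy_Schwarz_ineq_sum[of c "\<lambda>p. p z" P] by simp
  moreover have "(\<integral>x. (q x)\<^sup>2 \<partial>\<nu>) = (\<Sum>p\<in>P. (c p)\<^sup>2)"
    unfolding c by (rule integral_square_expansion[OF \<nu> P(1)])
  ultimately show ?thesis unfolding P(2) by (simp only: mult.commute)
qed

text \<open>
  The reproducing kernel at \<open>z\<close>, the polynomial with coordinates \<open>p z\<close>, has both its value at \<open>z\<close> and its
  squared norm equal to the Christoffel polynomial at \<open>z\<close>. So testing with it is enough.
\<close>

lemma christoffel_poly_upper:
  assumes D: "finite D" and \<nu>: "definite_on_polys D n \<nu>" and M: "M \<ge> 0"
    and le: "\<And>q. q \<in> coordwise_polys D n \<Longrightarrow> (q z)\<^sup>2 \<le> M * (\<integral>x. (q x)\<^sup>2 \<partial>\<nu>)"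
  shows "christoffel_poly D n \<nu> z \<le> M"
proof -
  obtain P where P: "orthonormal_poly_basis D n \<nu> P" "christoffel_poly D n \<nu> z = (\<Sum>p\<in>P. (p z)\<^sup>2)"
    using christoffel_poly_eq[OF D \<nu>] by metis
  let ?K = "\<Sum>p\<in>P. (p z)\<^sup>2"
  have "(\<lambda>x. \<Sum>p\<in>P. p z * p x) \<in> coordwise_polys D n"
    using P(1) by (intro coordwise_polys_sum) (auto simp: orthonormal_poly_basis_def)
  from le[OF this] have "?K * ?K \<le> M * ?K"
    using integral_square_expansion[OF \<nu> P(1), of "\<lambda>p. p z"] by (simp add: power2_eq_square)
  moreover have "?K \<ge> 0" by (intro sum_nonneg) simp
  ultimately show ?thesis using M P(2) by (cases "?K = 0") auto
qed

text \<open>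
  Bounded support makes all polynomials integrable. Definiteness on polynomials is kept apart, since
  its proof for measures with a density relies on this integrability.
\<close>

locale bounded_on_coords =
  fixes \<mu> :: "(nat \<Rightarrow> real) measure" and I :: "nat set" and R :: real
  assumes fin: "finite I"
    and prob: "prob_space \<mu>"
    and sets_eq: "sets \<mu> = sets (lebesgue_on_coords I)"
    and bounded: "AE y in \<mu>. \<forall>k\<in>I. \<bar>y k\<bar> \<le> R"
begin

lemma poly_measurable:
  assumes "D \<subseteq> I" "p \<in> coordwise_polys D n"
  shows "p \<in> borel_measurable \<mu>"
  using coordwise_polys_measurable[OF assms(2,1)] measurable_cong_sets[OF sets_eq refl] by blast

lemma poly_integrable:
  assumes "D \<subseteq> I" "p \<in> coordwise_polys D n"
  shows "integrable \<mu> p"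
proof -
  interpret prob_space \<mu> by (rule prob)
  obtain M where M: "\<And>y. (\<forall>k\<in>D. \<bar>y k\<bar> \<le> R) \<Longrightarrow> \<bar>p y\<bar> \<le> M"
    using coordwise_polys_bounded[OF assms(2)] by blast
  have "AE y in \<mu>. norm (p y) \<le> M"
    using bounded
  proof eventually_elim
    case (elim y)
    then have "\<forall>k\<in>D. \<bar>y k\<bar> \<le> R" using assms(1) by blast
    then show ?case using M by simp
  qed
  then show ?thesis by (intro integrable_const_bound[of _ M] poly_measurable[OF assms])
qed

text \<open>
  Norms of polynomials in the variables of \<open>D\<close> can be computed in the full space, which makes
  different marginals comparable.
\<close>

lemma integral_marginal:
  assumes D: "D \<subseteq> I" and p: "p \<in> coordwise_polys D n"
  shows "(\<integral>y. p y \<partial>marginal \<mu> D) = (\<integral>y. p y \<partial>\<mu>)"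
    and "integrable (marginal \<mu> D) p"
proof -
  have r: "(\<lambda>y. restrict y D) \<in> measurable \<mu> (lebesgue_on_coords D)"
    using measurable_restrict_subset[OF D, of "\<lambda>_. lborel"] measurable_cong_sets[OF sets_eq refl] by blast
  have pm: "p \<in> borel_measurable (lebesgue_on_coords D)"
    using coordwise_polys_measurable[OF p, of D] by simp
  have eq: "(\<lambda>y. p (restrict y D)) = p"
    by (rule ext, rule coordwise_polys_cong[OF p]) simp
  show "(\<integral>y. p y \<partial>marginal \<mu> D) = (\<integral>y. p y \<partial>\<mu>)"
    unfolding marginal_def by (subst integral_distr[OF r pm]) (simp add: eq)
  show "integrable (marginal \<mu> D) p"
    unfolding marginal_def by (subst integrable_distr_eq[OF r pm]) (simp add: eq poly_integrable[OF D p])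
qed

end

locale bounded_definite = bounded_on_coords +
  assumes definite: "\<And>D n p. D \<subseteq> I \<Longrightarrow> p \<in> coordwise_polys D n \<Longrightarrow> (\<integral>y. (p y)\<^sup>2 \<partial>\<mu>) = 0 \<Longrightarrow> p = (\<lambda>_. 0)"
begin

lemma definite_marginal:
  assumes D: "D \<subseteq> I"
  shows "definite_on_polys D n (marginal \<mu> D)"
proof -
  have "finite D" using D fin by (rule finite_subset)
  note prod = coordwise_polys_mult[OF this]
  show ?thesis
    unfolding definite_on_polys_def
    using integral_marginal[OF D prod] definite[OF D] by (auto simp: power2_eq_square)
qed

abbreviation christoffel :: "nat set \<Rightarrow> nat \<Rightarrow> (nat \<Rightarrow> real) \<Rightarrow> real" where
  "christoffel D n x \<equiv> christoffel_poly D n (marginal \<mu> D) (restrict x D)"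

lemma christoffel_lower:
  assumes D: "D \<subseteq> I" and q: "q \<in> coordwise_polys D n"
  shows "(q x)\<^sup>2 \<le> christoffel D n x * (\<integral>y. (q y)\<^sup>2 \<partial>\<mu>)"
proof -
  have fD: "finite D" using D fin by (rule finite_subset)
  have "(\<integral>y. (q y)\<^sup>2 \<partial>marginal \<mu> D) = (\<integral>y. (q y)\<^sup>2 \<partial>\<mu>)"
    by (rule integral_marginal(1)[OF D coordwise_polys_power[OF fD q]])
  moreover have "q (restrict x D) = q x" by (rule coordwise_polys_cong[OF q]) simp
  ultimately show ?thesis
    using christoffel_poly_lower[OF fD definite_marginal[OF D] q, of "restrict x D"] by simp
qed

lemma christoffel_upper:
  assumes D: "D \<subseteq> I" and M: "M \<ge> 0"
    and le: "\<And>q. q \<in> coordwise_polys D n \<Longrightarrow> (q x)\<^sup>2 \<le> M * (\<integral>y. (q y)\<^sup>2 \<partial>\<mu>)"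
  shows "christoffel D n x \<le> M"
proof -
  have fD: "finite D" using D fin by (rule finite_subset)
  show ?thesis
  proof (rule christoffel_poly_upper[OF fD definite_marginal[OF D] M])
    fix q assume q: "q \<in> coordwise_polys D n"
    have "(\<integral>y. (q y)\<^sup>2 \<partial>marginal \<mu> D) = (\<integral>y. (q y)\<^sup>2 \<partial>\<mu>)"
      by (rule integral_marginal(1)[OF D coordwise_polys_power[OF fD q]])
    moreover have "q (restrict x D) = q x" by (rule coordwise_polys_cong[OF q]) simp
    ultimately show "(q (restrict x D))\<^sup>2 \<le> M * (\<integral>y. (q y)\<^sup>2 \<partial>marginal \<mu> D)"
      using le[OF q] by simp
  qed
qed

lemma christoffel_ge_1:
  assumes D: "D \<subseteq> I"
  shows "1 \<le> christoffel D n x"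
proof -
  interpret prob_space \<mu> by (rule prob)
  have "finite D" using D fin by (rule finite_subset)
  then show ?thesis
    using christoffel_lower[OF D coordwise_polys_const, of 1 n x] by (simp add: prob_space)
qed

text \<open>
  More variables give more competitors in the extremal problem.
\<close>

lemma christoffel_mono:
  assumes D: "D \<subseteq> C" and C: "C \<subseteq> I"
  shows "christoffel D n x \<le> christoffel C n x"
proof (rule christoffel_upper)
  show "D \<subseteq> I" using assms by simp
  show "0 \<le> christoffel C n x" using christoffel_ge_1[OF C, of n x] by simp
  fix q assume "q \<in> coordwise_polys D n"
  then have "q \<in> coordwise_polys C n"
    using coordwise_polys_mono[OF finite_subset[OF C fin] D order.refl] by auto
  then show "(q x)\<^sup>2 \<le> christoffel C n x * (\<integral>y. (q y)\<^sup>2 \<partial>\<mu>)" by (rule christoffel_lower[OF C])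
qed

end

section \<open>A pointwise bound for univariate polynomials\<close>

definition sine_polys :: "nat \<Rightarrow> (real \<Rightarrow> real) set" where
  "sine_polys n = {g. \<exists>b. g = (\<lambda>\<theta>. \<Sum>k\<le>n. b k * sin (real (Suc k) * \<theta>))}"

lemma sine_polys_basis:
  assumes "k \<le> n"
  shows "(\<lambda>\<theta>. sin (real (Suc k) * \<theta>)) \<in> sine_polys n"
proof -
  have "(\<lambda>\<theta>. sin (real (Suc k) * \<theta>)) = (\<lambda>\<theta>. \<Sum>j\<le>n. (if j = k then 1 else 0) * sin (real (Suc j) * \<theta>))"
    using assms by (simp add: if_distrib[of "\<lambda>x. x * _"] cong: if_cong)
  then show ?thesis
    unfolding sine_polys_def mem_Collect_eq by (rule exI[of _ "\<lambda>j. if j = k then 1 else 0"])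
qed

lemma sine_polys_sum:
  assumes "\<And>i. i \<in> A \<Longrightarrow> g i \<in> sine_polys n"
  shows "(\<lambda>\<theta>. \<Sum>i\<in>A. a i * g i \<theta>) \<in> sine_polys n"
proof -
  obtain b where b: "\<And>i. i \<in> A \<Longrightarrow> g i = (\<lambda>\<theta>. \<Sum>k\<le>n. b i k * sin (real (Suc k) * \<theta>))"
    using assms unfolding sine_polys_def mem_Collect_eq by metis
  have "(\<Sum>i\<in>A. a i * g i \<theta>) = (\<Sum>k\<le>n. (\<Sum>i\<in>A. a i * b i k) * sin (real (Suc k) * \<theta>))" for \<theta>
  proof -
    have "(\<Sum>i\<in>A. a i * g i \<theta>) = (\<Sum>i\<in>A. \<Sum>k\<le>n. a i * b i k * sin (real (Suc k) * \<theta>))"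
      by (rule sum.cong) (simp_all add: b sum_distrib_left mult.assoc)
    also have "\<dots> = (\<Sum>k\<le>n. \<Sum>i\<in>A. a i * b i k * sin (real (Suc k) * \<theta>))"
      by (rule sum.swap)
    finally show ?thesis by (simp add: sum_distrib_right)
  qed
  then have "(\<lambda>\<theta>. \<Sum>i\<in>A. a i * g i \<theta>) =
      (\<lambda>\<theta>. \<Sum>k\<le>n. (\<Sum>i\<in>A. a i * b i k) * sin (real (Suc k) * \<theta>))" by (rule ext)
  then show ?thesis unfolding sine_polys_def mem_Collect_eq
    by (rule exI[of _ "\<lambda>k. \<Sum>i\<in>A. a i * b i k"])
qed

text \<open>
  This is \<open>2 cos \<theta> sin (k \<theta>) = sin ((k + 1) \<theta>) + sin ((k - 1) \<theta>)\<close>, where the last term is 0 for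
  \<open>k = 1\<close>.
\<close>

lemma cos_times_sine_polys:
  assumes "g \<in> sine_polys n"
  shows "(\<lambda>\<theta>. cos \<theta> * g \<theta>) \<in> sine_polys (Suc n)"
proof -
  obtain b where b: "g = (\<lambda>\<theta>. \<Sum>k\<le>n. b k * sin (real (Suc k) * \<theta>))"
    using assms by (auto simp: sine_polys_def)
  have prod: "(\<lambda>\<theta>. cos \<theta> * sin (real (Suc k) * \<theta>)) \<in> sine_polys (Suc n)" if "k \<le> n" for k
  proof (cases k)
    case 0
    have "(\<lambda>\<theta>. \<Sum>i\<in>{0::nat}. 1/2 * sin (real (Suc (Suc 0)) * \<theta>)) \<in> sine_polys (Suc n)"
      by (intro sine_polys_sum sine_polys_basis) simp
    moreover have "(\<lambda>\<theta>. \<Sum>i\<in>{0::nat}. 1/2 * sin (real (Suc (Suc 0)) * \<theta>)) =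
        (\<lambda>\<theta>. cos \<theta> * sin (real (Suc k) * \<theta>))"
      using 0 by (auto simp: sin_double)
    ultimately show ?thesis by simp
  next
    case (Suc j)
    have "(\<lambda>\<theta>. \<Sum>i\<in>{j, Suc (Suc j)}. 1/2 * sin (real (Suc i) * \<theta>)) \<in> sine_polys (Suc n)"
      using that Suc by (intro sine_polys_sum sine_polys_basis) auto
    moreover have "(\<lambda>\<theta>. \<Sum>i\<in>{j, Suc (Suc j)}. 1/2 * sin (real (Suc i) * \<theta>)) =
        (\<lambda>\<theta>. cos \<theta> * sin (real (Suc k) * \<theta>))"
    proof
      fix \<theta> :: real
      have "sin (real (Suc k) * \<theta> + \<theta>) + sin (real (Suc k) * \<theta> - \<theta>) = 2 * (cos \<theta> * sin (real (Suc k) * \<theta>))"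
        by (simp add: sin_add sin_diff mult.commute del: of_nat_Suc)
      moreover have "real (Suc k) * \<theta> + \<theta> = real (Suc (Suc (Suc j))) * \<theta>"
        "real (Suc k) * \<theta> - \<theta> = real (Suc j) * \<theta>"
        using Suc by (simp_all add: algebra_simps)
      ultimately show "(\<Sum>i\<in>{j, Suc (Suc j)}. 1/2 * sin (real (Suc i) * \<theta>)) = cos \<theta> * sin (real (Suc k) * \<theta>)"
        by simp
    qed
    ultimately show ?thesis by simp
  qed
  have "(\<lambda>\<theta>. \<Sum>k\<le>n. b k * (cos \<theta> * sin (real (Suc k) * \<theta>))) \<in> sine_polys (Suc n)"
    by (intro sine_polys_sum prod) simp
  moreover have "(\<lambda>\<theta>. \<Sum>k\<le>n. b k * (cos \<theta> * sin (real (Suc k) * \<theta>))) = (\<lambda>\<theta>. cos \<theta> * g \<theta>)"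
    by (simp add: b sum_distrib_left algebra_simps)
  ultimately show ?thesis by simp
qed

lemma sine_polys_mono:
  assumes "m \<le> n"
  shows "sine_polys m \<subseteq> sine_polys n"
proof
  fix g assume "g \<in> sine_polys m"
  then obtain b where b: "g = (\<lambda>\<theta>. \<Sum>k\<le>m. b k * sin (real (Suc k) * \<theta>))"
    by (auto simp: sine_polys_def)
  show "g \<in> sine_polys n"
    unfolding b using assms by (intro sine_polys_sum sine_polys_basis) simp
qed

text \<open>
  In other words, polynomials are combinations of Chebyshev polynomials of the second kind, the
  \<open>k\<close>-th of which takes the value \<open>sin ((k + 1) \<theta>) / sin \<theta>\<close> at \<open>cos \<theta>\<close>.
\<close>

lemma poly_cos_times_sin:
  assumes "degree p \<le> n"
  shows "(\<lambda>\<theta>. poly p (cos \<theta>) * sin \<theta>) \<in> sine_polys n"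
proof -
  have pow: "(\<lambda>\<theta>. cos \<theta> ^ j * sin \<theta>) \<in> sine_polys j" for j
  proof (induction j)
    case 0
    show ?case using sine_polys_basis[of 0 0] by simp
  next
    case (Suc j)
    then show ?case using cos_times_sine_polys[OF Suc] by (simp add: mult.assoc)
  qed
  have "(\<lambda>\<theta>. \<Sum>j\<le>degree p. coeff p j * (cos \<theta> ^ j * sin \<theta>)) \<in> sine_polys n"
    using pow sine_polys_mono assms by (intro sine_polys_sum) (meson atMost_iff order_trans subsetD)
  moreover have "(\<lambda>\<theta>. \<Sum>j\<le>degree p. coeff p j * (cos \<theta> ^ j * sin \<theta>)) = (\<lambda>\<theta>. poly p (cos \<theta>) * sin \<theta>)"
    by (simp add: poly_altdef sum_distrib_right mult.assoc)
  ultimately show ?thesis by simp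
qed

lemma sines_orthogonal:
  "((\<lambda>\<theta>. sin (real (Suc k) * \<theta>) * sin (real (Suc l) * \<theta>)) has_integral (if k = l then pi / 2 else 0)) {0..pi}"
proof (cases "k = l")
  case True
  define s where "s = real (Suc k)"
  have s: "s > 0" by (simp add: s_def)
  define F where "F \<theta> = \<theta> / 2 - sin (2 * s * \<theta>) / (4 * s)" for \<theta>
  have "((\<lambda>\<theta>. sin (s * \<theta>) * sin (s * \<theta>)) has_integral (F pi - F 0)) {0..pi}"
  proof (rule fundamental_theorem_of_calculus)
    fix \<theta> :: real
    have "cos (2 * s * \<theta>) = 1 - 2 * (sin (s * \<theta>) * sin (s * \<theta>))"
      using cos_double_sin[of "s * \<theta>"] by (simp add: power2_eq_square mult.assoc)
    then have eq: "sin (s * \<theta>) * sin (s * \<theta>) = 1 / 2 - cos (2 * s * \<theta>) * (2 * s) / (4 * s)"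
      using s by (simp add: field_simps)
    show "(F has_vector_derivative sin (s * \<theta>) * sin (s * \<theta>)) (at \<theta> within {0..pi})"
      unfolding eq F_def has_real_derivative_iff_has_vector_derivative[symmetric]
      using s by (auto intro!: derivative_eq_intros)
  qed simp
  moreover have "F pi - F 0 = pi / 2"
    using sin_npi[of "2 * Suc k"] by (simp add: F_def s_def)
  ultimately show ?thesis using True by (simp add: s_def)
next
  case False
  define s t where "s = real k - real l" and "t = real k + real l + 2"
  have st: "s \<noteq> 0" "t \<noteq> 0" using False by (auto simp: s_def t_def)
  define F where "F \<theta> = sin (s * \<theta>) / (2 * s) - sin (t * \<theta>) / (2 * t)" for \<theta>
  have "((\<lambda>\<theta>. sin (real (Suc k) * \<theta>) * sin (real (Suc l) * \<theta>)) has_integral (F pi - F 0)) {0..pi}"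
  proof (rule fundamental_theorem_of_calculus)
    fix \<theta> :: real
    have "s * \<theta> = real (Suc k) * \<theta> - real (Suc l) * \<theta>" "t * \<theta> = real (Suc k) * \<theta> + real (Suc l) * \<theta>"
      by (simp_all add: s_def t_def algebra_simps)
    then have "sin (real (Suc k) * \<theta>) * sin (real (Suc l) * \<theta>) = (cos (s * \<theta>) - cos (t * \<theta>)) / 2"
      by (simp only: cos_add cos_diff) simp
    also have "\<dots> = cos (s * \<theta>) * s / (2 * s) - cos (t * \<theta>) * t / (2 * t)"
      using st by (simp add: field_simps)
    finally have eq: "sin (real (Suc k) * \<theta>) * sin (real (Suc l) * \<theta>) =
        cos (s * \<theta>) * s / (2 * s) - cos (t * \<theta>) * t / (2 * t)" .
    show "(F has_vector_derivative sin (real (Suc k) * \<theta>) * sin (real (Suc l) * \<theta>)) (at \<theta> within {0..pi})"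
      unfolding eq F_def has_real_derivative_iff_has_vector_derivative[symmetric]
      using st by (auto intro!: derivative_eq_intros)
  qed simp
  moreover have "F pi - F 0 = 0"
  proof -
    have "sin (s * pi) = 0" "sin (t * pi) = 0"
      using sin_npi_int[of "int k - int l"] sin_npi_int[of "int k + int l + 2"]
      by (simp_all add: s_def t_def mult.commute)
    then show ?thesis by (simp add: F_def)
  qed
  ultimately show ?thesis using False by simp
qed

lemma sine_poly_Parseval:
  "((\<lambda>\<theta>. (\<Sum>k\<le>n. b k * sin (real (Suc k) * \<theta>))\<^sup>2) has_integral (pi / 2 * (\<Sum>k\<le>n. (b k)\<^sup>2))) {0..pi}"
proof -
  have "((\<lambda>\<theta>. \<Sum>k\<le>n. \<Sum>l\<le>n. (b k * b l) * (sin (real (Suc k) * \<theta>) * sin (real (Suc l) * \<theta>)))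
      has_integral (\<Sum>k\<le>n. \<Sum>l\<le>n. (b k * b l) * (if k = l then pi / 2 else 0))) {0..pi}"
    by (intro has_integral_sum has_integral_mult_right sines_orthogonal finite_atMost)
  moreover have "(\<Sum>k\<le>n. \<Sum>l\<le>n. (b k * b l) * (if k = l then pi / 2 else 0)) = pi / 2 * (\<Sum>k\<le>n. (b k)\<^sup>2)"
    by (simp add: if_distrib[of "\<lambda>x. _ * x"] sum_distrib_left power2_eq_square mult_ac cong: if_cong)
  moreover have "(\<lambda>\<theta>. \<Sum>k\<le>n. \<Sum>l\<le>n. (b k * b l) * (sin (real (Suc k) * \<theta>) * sin (real (Suc l) * \<theta>))) =
      (\<lambda>\<theta>. (\<Sum>k\<le>n. b k * sin (real (Suc k) * \<theta>))\<^sup>2)"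
    unfolding power2_eq_square sum_product by (intro ext sum.cong refl) (simp only: mult_ac)
  ultimately show ?thesis by simp
qed

text \<open>
  After the substitution \<open>t = c - \<epsilon> cos \<theta>\<close>, multiplication with \<open>sin \<theta>\<close> turns \<open>p\<close> into a sine polynomial
  with \<open>n + 1\<close> terms whose value at \<open>\<theta> = \<pi>/2\<close> is \<open>p(c)\<close>. By Cauchy-Schwarz the square of this value is
  at most \<open>n + 1\<close> times the sum of the squared coefficients, which is a multiple of the integral of the
  square of the sine polynomial. The Jacobian \<open>\<epsilon> sin \<theta>\<close> carries only one of the two factors \<open>sin \<theta>\<close> of
  that square, and the other one is at most 1. The order \<open>n\<close> relies on \<open>c\<close> being away from the ends of
  the interval, where it would be \<open>n\<^sup>2\<close>.
\<close>

lemma poly_midpoint_square_le: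
  fixes p :: "real poly"
  assumes deg: "degree p \<le> n" and eps: "\<epsilon> > 0"
  shows "ennreal ((poly p c)\<^sup>2) \<le> ennreal (2 / (pi * \<epsilon>) * (real n + 1)) *
           (\<integral>\<^sup>+t. ennreal ((poly p t)\<^sup>2) * indicator {c - \<epsilon>..c + \<epsilon>} t \<partial>lborel)"
proof -
  define q where "q = pcompose p [:c, -\<epsilon>:]"
  have q: "poly q x = poly p (c - \<epsilon> * x)" for x
    by (simp add: q_def poly_pcompose algebra_simps)
  have "degree q \<le> n" using deg by (simp add: q_def degree_pcompose)
  then obtain b where "(\<lambda>\<theta>. poly q (cos \<theta>) * sin \<theta>) = (\<lambda>\<theta>. \<Sum>k\<le>n. b k * sin (real (Suc k) * \<theta>))"
    using poly_cos_times_sin[of q n] by (auto simp: sine_polys_def)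
  then have b: "poly q (cos \<theta>) * sin \<theta> = (\<Sum>k\<le>n. b k * sin (real (Suc k) * \<theta>))" for \<theta>
    by meson
  have [measurable]: "poly p \<in> borel_measurable borel"
    by (intro borel_measurable_continuous_onI continuous_intros)
  define B where "B = (\<Sum>k\<le>n. (b k)\<^sup>2)"
  have "poly p c = poly q (cos (pi / 2)) * sin (pi / 2)" by (simp add: q)
  then have "(poly p c)\<^sup>2 = (\<Sum>k\<le>n. b k * sin (real (Suc k) * (pi / 2)))\<^sup>2" by (simp only: b)
  also have "\<dots> \<le> B * (\<Sum>k\<le>n. (sin (real (Suc k) * (pi / 2)))\<^sup>2)"
    unfolding B_def by (rule Cauchy_Schwarz_ineq_sum)
  also have "\<dots> \<le> B * (\<Sum>k\<le>n. 1)"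
    by (intro mult_left_mono sum_mono) (auto simp: B_def sum_nonneg abs_square_le_1)
  finally have val: "(poly p c)\<^sup>2 \<le> (real n + 1) * B" by (simp add: algebra_simps)

  have "ennreal (\<epsilon> * (pi / 2 * B)) =
      (\<integral>\<^sup>+\<theta>. ennreal (\<epsilon> * (\<Sum>k\<le>n. b k * sin (real (Suc k) * \<theta>))\<^sup>2) * indicator {0..pi} \<theta> \<partial>lborel)"
    using has_integral_mult_right[OF sine_poly_Parseval[of b n], of \<epsilon>] eps
    by (intro nn_integral_has_integral_lebesgue'[symmetric]) (auto simp: B_def)
  also have "\<dots> \<le> (\<integral>\<^sup>+\<theta>. ennreal ((poly p (c - \<epsilon> * cos \<theta>))\<^sup>2 * (\<epsilon> * sin \<theta>) * indicator {0..pi} \<theta>) \<partial>lborel)"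
  proof (intro nn_integral_mono)
    fix \<theta> :: real
    show "ennreal (\<epsilon> * (\<Sum>k\<le>n. b k * sin (real (Suc k) * \<theta>))\<^sup>2) * indicator {0..pi} \<theta> \<le>
        ennreal ((poly p (c - \<epsilon> * cos \<theta>))\<^sup>2 * (\<epsilon> * sin \<theta>) * indicator {0..pi} \<theta>)"
    proof (cases "\<theta> \<in> {0..pi}")
      case True
      then have s: "0 \<le> sin \<theta>" by (auto intro: sin_ge_zero)
      have "(sin \<theta>)\<^sup>2 \<le> sin \<theta> * 1" unfolding power2_eq_square by (intro mult_left_mono s) simp
      then have "(poly q (cos \<theta>))\<^sup>2 * \<epsilon> * (sin \<theta>)\<^sup>2 \<le> (poly q (cos \<theta>))\<^sup>2 * \<epsilon> * sin \<theta>"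
        using eps by (intro mult_left_mono) auto
      moreover have "(\<Sum>k\<le>n. b k * sin (real (Suc k) * \<theta>))\<^sup>2 = (poly q (cos \<theta>))\<^sup>2 * (sin \<theta>)\<^sup>2"
        by (simp only: b[symmetric] power_mult_distrib)
      ultimately show ?thesis using True by (simp add: q[symmetric] mult_ac ennreal_leI del: of_nat_Suc)
    qed simp
  qed
  also have "\<dots> = (\<integral>\<^sup>+t. ennreal ((poly p t)\<^sup>2 * indicator {c - \<epsilon> * cos 0..c - \<epsilon> * cos pi} t) \<partial>lborel)"
    using eps
    by (intro nn_integral_substitution[where g="\<lambda>\<theta>. c - \<epsilon> * cos \<theta>", symmetric])
       (auto simp: set_borel_measurable_def sin_ge_zero intro!: derivative_eq_intros continuous_intros)
  also have "\<dots> = (\<integral>\<^sup>+t. ennreal ((poly p t)\<^sup>2) * indicator {c - \<epsilon>..c + \<epsilon>} t \<partial>lborel)"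
    by (intro nn_integral_cong) (auto split: split_indicator)
  finally have int: "ennreal (\<epsilon> * (pi / 2 * B)) \<le>
      (\<integral>\<^sup>+t. ennreal ((poly p t)\<^sup>2) * indicator {c - \<epsilon>..c + \<epsilon>} t \<partial>lborel)" .
  have "ennreal ((poly p c)\<^sup>2) \<le> ennreal ((2 / (pi * \<epsilon>) * (real n + 1)) * (\<epsilon> * (pi / 2 * B)))"
  proof (intro ennreal_leI)
    have "2 / (pi * \<epsilon>) * (real n + 1) * (\<epsilon> * (pi / 2 * B)) = (real n + 1) * B"
      using eps by (simp add: field_simps)
    then show "(poly p c)\<^sup>2 \<le> 2 / (pi * \<epsilon>) * (real n + 1) * (\<epsilon> * (pi / 2 * B))"
      using val by simp
  qed
  also have "\<dots> = ennreal (2 / (pi * \<epsilon>) * (real n + 1)) * ennreal (\<epsilon> * (pi / 2 * B))"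
    using eps by (intro ennreal_mult) (auto simp: B_def sum_nonneg)
  also have "\<dots> \<le> ennreal (2 / (pi * \<epsilon>) * (real n + 1)) *
      (\<integral>\<^sup>+t. ennreal ((poly p t)\<^sup>2) * indicator {c - \<epsilon>..c + \<epsilon>} t \<partial>lborel)"
    by (intro mult_left_mono int) simp
  finally show ?thesis .
qed

section \<open>Growth at interior points\<close>

text \<open>
  The univariate bound is applied in one coordinate after the other, with Fubini's theorem.
\<close>

lemma box_square_le:
  assumes D: "finite D" and eps: "\<epsilon> > 0" and q: "q \<in> coordwise_polys D n"
  shows "ennreal ((q z)\<^sup>2) \<le> ennreal (2 / (pi * \<epsilon>) * (real n + 1)) ^ card D *
    (\<integral>\<^sup>+y. ennreal ((q y)\<^sup>2) * indicator (\<Pi>\<^sub>E k\<in>D. {z k - \<epsilon>..z k + \<epsilon>}) y \<partial>lebesgue_on_coords D)"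
  using D q
proof (induction D arbitrary: q rule: finite_induct)
  case empty
  interpret product_sigma_finite "\<lambda>_::nat. lborel" by standard
  have "q (\<lambda>_. undefined) = q z" by (rule coordwise_polys_cong[OF empty]) simp
  then show ?case by (subst nn_integral_empty) auto
next
  case (insert k D)
  interpret product_sigma_finite "\<lambda>_::nat. lborel" by standard
  let ?C = "ennreal (2 / (pi * \<epsilon>) * (real n + 1))"
  let ?B = "\<lambda>D. \<Pi>\<^sub>E k\<in>D. {z k - \<epsilon>..z k + \<epsilon>}"
  define h where "h y = ennreal ((q y)\<^sup>2) * indicator (?B (insert k D)) y" for y
  obtain r where r: "\<And>j. r j \<in> coordwise_polys D n" "q = (\<lambda>x. \<Sum>j\<le>n. x k ^ j * r j x)"
    using coordwise_polys_insert[OF insert.hyps insert.prems] by blast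
  have [measurable]: "?B (insert k D) \<in> sets (lebesgue_on_coords (insert k D))"
    using insert.hyps by (intro sets_PiM_I_finite) auto
  have [measurable]: "q \<in> borel_measurable (lebesgue_on_coords (insert k D))"
    by (rule coordwise_polys_measurable[OF insert.prems order.refl])
  have h: "h \<in> borel_measurable (lebesgue_on_coords (insert k D))"
    unfolding h_def by measurable
  have slice: "(\<lambda>x. \<integral>\<^sup>+t. h (x(k := t)) \<partial>lborel) \<in> borel_measurable (lebesgue_on_coords D)"
  proof (rule lborel.borel_measurable_nn_integral)
    show "(\<lambda>(x, t). h (x(k := t))) \<in> borel_measurable (lebesgue_on_coords D \<Otimes>\<^sub>M lborel)"
      using measurable_compose[OF measurable_add_dim[of k D "\<lambda>_. lborel"] h]
      by (simp add: case_prod_unfold)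
  qed
  define q' where "q' = (\<lambda>x. \<Sum>j\<le>n. z k ^ j * r j x)"
  have q': "q' \<in> coordwise_polys D n" unfolding q'_def by (intro coordwise_polys_sum r)
  have upd: "r j (x(k := t)) = r j x" for j x t
    using insert.hyps(2) by (intro coordwise_polys_cong[OF r(1)]) auto
  have slice_ge: "ennreal ((q' x)\<^sup>2) * indicator (?B D) x \<le> ?C * (\<integral>\<^sup>+t. h (x(k := t)) \<partial>lborel)"
    if x: "x \<in> space (lebesgue_on_coords D)" for x
  proof (cases "x \<in> ?B D")
    case True
    define P where "P = (\<Sum>j\<le>n. monom (r j x) j)"
    have P: "poly P t = q (x(k := t))" for t
      by (simp add: P_def r(2) upd poly_sum poly_monom mult.commute)
    have "degree P \<le> n"
      unfolding P_def by (intro degree_sum_le) (auto intro: order_trans[OF degree_monom_le])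
    from poly_midpoint_square_le[OF this eps, of "z k"]
    have "ennreal ((q (x(k := z k)))\<^sup>2) \<le>
        ?C * (\<integral>\<^sup>+t. ennreal ((q (x(k := t)))\<^sup>2) * indicator {z k - \<epsilon>..z k + \<epsilon>} t \<partial>lborel)"
      by (simp only: P)
    also have "(\<integral>\<^sup>+t. ennreal ((q (x(k := t)))\<^sup>2) * indicator {z k - \<epsilon>..z k + \<epsilon>} t \<partial>lborel) =
        (\<integral>\<^sup>+t. h (x(k := t)) \<partial>lborel)"
    proof (rule nn_integral_cong)
      fix t :: real
      have "x(k := t) \<in> ?B (insert k D) \<longleftrightarrow> t \<in> {z k - \<epsilon>..z k + \<epsilon>}"
        using True insert.hyps(2) by (auto simp: PiE_iff extensional_def)
      then show "ennreal ((q (x(k := t)))\<^sup>2) * indicator {z k - \<epsilon>..z k + \<epsilon>} t = h (x(k := t))"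
        unfolding h_def indicator_def by simp
    qed
    finally have "ennreal ((q (x(k := z k)))\<^sup>2) \<le> ?C * (\<integral>\<^sup>+t. h (x(k := t)) \<partial>lborel)" .
    moreover have "q (x(k := z k)) = q' x" by (simp only: r(2) q'_def upd fun_upd_same)
    ultimately show ?thesis using True by simp
  qed simp
  have "q' z = q z" by (simp add: q'_def r(2))
  then have "ennreal ((q z)\<^sup>2) \<le> ?C ^ card D *
      (\<integral>\<^sup>+x. ennreal ((q' x)\<^sup>2) * indicator (?B D) x \<partial>lebesgue_on_coords D)"
    using insert.IH[OF q'] by simp
  also have "\<dots> \<le> ?C ^ card D * (\<integral>\<^sup>+x. ?C * (\<integral>\<^sup>+t. h (x(k := t)) \<partial>lborel) \<partial>lebesgue_on_coords D)"
    by (intro mult_left_mono nn_integral_mono slice_ge) auto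
  also have "\<dots> = ?C ^ card (insert k D) * (\<integral>\<^sup>+x. (\<integral>\<^sup>+t. h (x(k := t)) \<partial>lborel) \<partial>lebesgue_on_coords D)"
    using insert.hyps by (subst nn_integral_cmult[OF slice]) (simp add: mult_ac)
  also have "(\<integral>\<^sup>+x. (\<integral>\<^sup>+t. h (x(k := t)) \<partial>lborel) \<partial>lebesgue_on_coords D) =
      (\<integral>\<^sup>+y. h y \<partial>lebesgue_on_coords (insert k D))"
    by (rule product_nn_integral_insert[OF insert.hyps h, symmetric])
  finally show ?case unfolding h_def .
qed

lemma ennreal_integral_le_nn_integral:
  assumes "\<And>x. x \<in> space M \<Longrightarrow> 0 \<le> g x"
  shows "ennreal (integral\<^sup>L M g) \<le> (\<integral>\<^sup>+x. ennreal (g x) \<partial>M)"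
proof (cases "integrable M g")
  case True
  then show ?thesis using assms by (subst nn_integral_eq_integral) auto
qed (simp add: not_integrable_integral_eq)

text \<open>
  Fubini's theorem, as an inequality because \<open>marginal_density\<close> takes the value 0 at points where the
  integral that defines it diverges.
\<close>

lemma marginal_density_nn_integral_le:
  fixes g :: "(nat \<Rightarrow> real) \<Rightarrow> ennreal"
  assumes f: "f \<in> borel_measurable (lebesgue_on_coords {1..d})"
    and nonneg: "\<forall>y \<in> {1..d} \<rightarrow>\<^sub>E UNIV. f y \<ge> 0"
    and \<mu>: "\<mu> = density (lebesgue_on_coords {1..d}) (\<lambda>y. ennreal (f y))"
    and D: "D \<subseteq> {1..d}"
    and g: "g \<in> borel_measurable (lebesgue_on_coords D)"
  shows "(\<integral>\<^sup>+x. ennreal (marginal_density d f D x) * g x \<partial>lebesgue_on_coords D) \<le>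
         (\<integral>\<^sup>+y. g (restrict y D) \<partial>\<mu>)"
proof -
  interpret product_sigma_finite "\<lambda>_::nat. lborel" by standard
  define E where "E = {1..d} - D"
  have DE: "D \<inter> E = {}" "D \<union> E = {1..d}" "finite D" "finite E"
    using D by (auto simp: E_def intro: finite_subset)
  note f[measurable]
  have res[measurable]: "(\<lambda>y. restrict y D) \<in> measurable (lebesgue_on_coords {1..d}) (lebesgue_on_coords D)"
    by (rule measurable_restrict_subset[OF D])
  have gr[measurable]: "(\<lambda>y. g (restrict y D)) \<in> borel_measurable (lebesgue_on_coords {1..d})"
    by (rule measurable_compose[OF res g])
  have "(\<integral>\<^sup>+y. g (restrict y D) \<partial>\<mu>) =
      (\<integral>\<^sup>+y. ennreal (f y) * g (restrict y D) \<partial>lebesgue_on_coords {1..d})"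
    unfolding \<mu> by (rule nn_integral_density) measurable
  also have "\<dots> = (\<integral>\<^sup>+x. \<integral>\<^sup>+y. ennreal (f (merge D E (x, y))) * g (restrict (merge D E (x, y)) D)
      \<partial>lebesgue_on_coords E \<partial>lebesgue_on_coords D)"
  proof -
    have "(\<lambda>y. ennreal (f y) * g (restrict y D)) \<in> borel_measurable (lebesgue_on_coords (D \<union> E))"
      unfolding DE(2) by measurable
    from product_nn_integral_fold[OF DE(1,3,4) this] show ?thesis unfolding DE(2) .
  qed
  also have "\<dots> \<ge> (\<integral>\<^sup>+x. ennreal (marginal_density d f D x) * g x \<partial>lebesgue_on_coords D)"
  proof (rule nn_integral_mono)
    fix x assume x: "x \<in> space (lebesgue_on_coords D)"
    have xE: "x \<in> D \<rightarrow>\<^sub>E UNIV" using x by (simp add: space_PiM)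
    have m: "(\<lambda>y. f (merge D E (x, y))) \<in> borel_measurable (lebesgue_on_coords E)"
    proof -
      have "(\<lambda>y. merge D E (x, y)) \<in> measurable (lebesgue_on_coords E) (lebesgue_on_coords (D \<union> E))"
        using x by (intro measurable_compose[OF measurable_Pair1' measurable_merge])
      then show ?thesis unfolding DE(2) by (rule measurable_compose[OF _ f])
    qed
    have "ennreal (marginal_density d f D x) * g x \<le>
        (\<integral>\<^sup>+y. ennreal (f (merge D E (x, y))) \<partial>lebesgue_on_coords E) * g x"
      unfolding marginal_density_def E_def[symmetric]
    proof (intro mult_right_mono ennreal_integral_le_nn_integral)
      fix y assume "y \<in> space (lebesgue_on_coords E)"
      then have "merge D E (x, y) \<in> {1..d} \<rightarrow>\<^sub>E UNIV"
        unfolding DE(2)[symmetric] by (auto simp: merge_def PiE_def extensional_def)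
      then show "0 \<le> f (merge D E (x, y))" using nonneg by blast
    qed simp
    also have "\<dots> = (\<integral>\<^sup>+y. ennreal (f (merge D E (x, y))) * g x \<partial>lebesgue_on_coords E)"
      by (rule nn_integral_multc[symmetric]) (rule measurable_compose[OF m measurable_ennreal])
    also have "\<dots> = (\<integral>\<^sup>+y. ennreal (f (merge D E (x, y))) * g (restrict (merge D E (x, y)) D)
        \<partial>lebesgue_on_coords E)"
    proof (rule nn_integral_cong)
      fix y
      have "restrict (merge D E (x, y)) D = x"
        using xE by (auto simp: merge_def restrict_def PiE_def extensional_def)
      then show "ennreal (f (merge D E (x, y))) * g x =
          ennreal (f (merge D E (x, y))) * g (restrict (merge D E (x, y)) D)" by simp
    qed
    finally show "ennreal (marginal_density d f D x) * g x \<le>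
        (\<integral>\<^sup>+y. ennreal (f (merge D E (x, y))) * g (restrict (merge D E (x, y)) D) \<partial>lebesgue_on_coords E)" .
  qed
  finally show ?thesis .
qed

lemma (in bounded_on_coords) square_le_interior:
  assumes f: "f \<in> borel_measurable (lebesgue_on_coords {1..d})"
    and nonneg: "\<forall>y \<in> {1..d} \<rightarrow>\<^sub>E UNIV. f y \<ge> 0"
    and \<mu>: "\<mu> = density (lebesgue_on_coords {1..d}) (\<lambda>y. ennreal (f y))"
    and I: "I = {1..d}" and D: "D \<subseteq> I"
    and eps: "\<epsilon> > 0" and c: "c > 0"
    and dens: "\<And>y. y \<in> (\<Pi>\<^sub>E k\<in>D. {z k - \<epsilon>..z k + \<epsilon>}) \<Longrightarrow> c \<le> marginal_density d f D y"
    and q: "q \<in> coordwise_polys D n"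
  shows "(q z)\<^sup>2 \<le> ((2 / (pi * \<epsilon>) * (real n + 1)) ^ card D / c) * (\<integral>y. (q y)\<^sup>2 \<partial>\<mu>)"
proof -
  let ?C = "2 / (pi * \<epsilon>) * (real n + 1)"
  let ?B = "\<Pi>\<^sub>E k\<in>D. {z k - \<epsilon>..z k + \<epsilon>}"
  have C: "?C \<ge> 0" using eps by simp
  have fD: "finite D" using D fin by (rule finite_subset)
  have [measurable]: "?B \<in> sets (lebesgue_on_coords D)"
    using fD by (intro sets_PiM_I_finite) auto
  have [measurable]: "q \<in> borel_measurable (lebesgue_on_coords D)"
    by (rule coordwise_polys_measurable[OF q order.refl])
  have "ennreal c * ennreal ((q z)\<^sup>2) \<le> ennreal c * (ennreal ?C ^ card D *
      (\<integral>\<^sup>+y. ennreal ((q y)\<^sup>2) * indicator ?B y \<partial>lebesgue_on_coords D))"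
    by (intro mult_left_mono box_square_le[OF fD eps q]) simp
  also have "\<dots> = ennreal ?C ^ card D *
      (\<integral>\<^sup>+y. ennreal c * (ennreal ((q y)\<^sup>2) * indicator ?B y) \<partial>lebesgue_on_coords D)"
    by (subst nn_integral_cmult) (simp_all add: mult_ac)
  also have "\<dots> \<le> ennreal ?C ^ card D *
      (\<integral>\<^sup>+y. ennreal (marginal_density d f D y) * ennreal ((q y)\<^sup>2) \<partial>lebesgue_on_coords D)"
    by (intro mult_left_mono nn_integral_mono)
       (auto split: split_indicator intro!: mult_right_mono ennreal_leI dens)
  also have "\<dots> \<le> ennreal ?C ^ card D * (\<integral>\<^sup>+y. ennreal ((q (restrict y D))\<^sup>2) \<partial>\<mu>)"
    using D unfolding I
    by (intro mult_left_mono marginal_density_nn_integral_le[OF f nonneg \<mu>]) measurable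
  also have "(\<integral>\<^sup>+y. ennreal ((q (restrict y D))\<^sup>2) \<partial>\<mu>) = (\<integral>\<^sup>+y. ennreal ((q y)\<^sup>2) \<partial>\<mu>)"
  proof (rule nn_integral_cong)
    fix y
    have "q (restrict y D) = q y" by (rule coordwise_polys_cong[OF q]) simp
    then show "ennreal ((q (restrict y D))\<^sup>2) = ennreal ((q y)\<^sup>2)" by simp
  qed
  also have "\<dots> = ennreal (\<integral>y. (q y)\<^sup>2 \<partial>\<mu>)"
    by (intro nn_integral_eq_integral poly_integrable[OF D coordwise_polys_power[OF fD q]]) simp
  finally have "ennreal (c * (q z)\<^sup>2) \<le> ennreal (?C ^ card D * (\<integral>y. (q y)\<^sup>2 \<partial>\<mu>))"
    using c C by (simp add: ennreal_mult'[symmetric] ennreal_power)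
  then have "c * (q z)\<^sup>2 \<le> ?C ^ card D * (\<integral>y. (q y)\<^sup>2 \<partial>\<mu>)"
    using C by (subst (asm) ennreal_le_iff) (auto intro!: mult_nonneg_nonneg zero_le_power)
  then have "(q z)\<^sup>2 \<le> (?C ^ card D * (\<integral>y. (q y)\<^sup>2 \<partial>\<mu>)) / c"
    by (simp only: pos_le_divide_eq[OF c] mult.commute[of c])
  then show ?thesis by (simp only: times_divide_eq_left)
qed

lemma open_contains_box:
  assumes D: "finite D" and U: "openin (powertop_real D) U" and z: "z \<in> U"
  shows "\<exists>\<epsilon>>0. (\<Pi>\<^sub>E k\<in>D. {z k - \<epsilon>..z k + \<epsilon>}) \<subseteq> U"
proof -
  obtain V where V: "\<forall>i\<in>D. open (V i)" "z \<in> Pi\<^sub>E D V" "Pi\<^sub>E D V \<subseteq> U"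
    using U z unfolding openin_product_topology_alt by (metis open_openin)
  have "\<forall>i\<in>D. \<exists>e>0. {z i - e..z i + e} \<subseteq> V i"
  proof
    fix i assume "i \<in> D"
    then have "open (V i)" "z i \<in> V i" using V by auto
    then show "\<exists>e>0. {z i - e..z i + e} \<subseteq> V i"
      unfolding cball_eq_atLeastAtMost[symmetric] by (simp add: open_contains_cball)
  qed
  from bchoice[OF this] obtain e where e: "\<And>i. i \<in> D \<Longrightarrow> e i > 0" "\<And>i. i \<in> D \<Longrightarrow> {z i - e i..z i + e i} \<subseteq> V i"
    by blast
  define \<epsilon> where "\<epsilon> = Min (insert 1 (e ` D))"
  have le: "\<epsilon> \<le> e i" if "i \<in> D" for i unfolding \<epsilon>_def using D that by (intro Min_le) auto
  have "\<epsilon> > 0" unfolding \<epsilon>_def using D e(1) by (subst Min_gr_iff) auto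
  moreover have "(\<Pi>\<^sub>E k\<in>D. {z k - \<epsilon>..z k + \<epsilon>}) \<subseteq> Pi\<^sub>E D V"
  proof (rule PiE_mono)
    fix i assume "i \<in> D"
    then show "{z i - \<epsilon>..z i + \<epsilon>} \<subseteq> V i" using le[of i] e(2)[of i] by fastforce
  qed
  ultimately show ?thesis using V(3) by blast
qed

text \<open>
  The function is bounded below by half of its value at \<open>z\<close> near \<open>z\<close>.
\<close>

lemma continuous_positive_on_box:
  assumes D: "finite D" and W: "openin (powertop_real D) W" and z: "z \<in> W"
    and g: "continuous_map (subtopology (powertop_real D) W) euclideanreal g" and pos: "g z > 0"
  shows "\<exists>\<epsilon>>0. \<exists>c>0. \<forall>y\<in>(\<Pi>\<^sub>E k\<in>D. {z k - \<epsilon>..z k + \<epsilon>}). c \<le> g y"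
proof -
  let ?U = "{y \<in> topspace (subtopology (powertop_real D) W). g y \<in> {g z / 2<..}}"
  have "openin (subtopology (powertop_real D) W) ?U"
    by (rule openin_continuous_map_preimage[OF g]) simp
  then have "openin (powertop_real D) ?U" using W by (rule openin_trans_full)
  moreover have "z \<in> ?U" using z pos openin_subset[OF W] by auto
  ultimately obtain \<epsilon> where "\<epsilon> > 0" "(\<Pi>\<^sub>E k\<in>D. {z k - \<epsilon>..z k + \<epsilon>}) \<subseteq> ?U"
    using open_contains_box[OF D] by blast
  then show ?thesis using pos by (intro exI[of _ \<epsilon>] conjI exI[of _ "g z / 2"]) auto
qed

section \<open>Growth at exterior points\<close>

text \<open>
  The polynomial \<open>1 - |y - x|\<^sup>2 / L\<close>, with \<open>|y - x|\<close> the distance in the coordinates of \<open>D\<close>, takes the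
  value 1 at \<open>x\<close> and values in \<open>[0, \<rho>]\<close> on the support, where \<open>\<rho> < 1\<close>. Its powers are competitors in
  the extremal problem.
\<close>

lemma (in bounded_definite) christoffel_exponential_growth:
  assumes D: "D \<subseteq> I" and \<delta>: "\<delta> > 0"
    and sep: "AE y in \<mu>. \<delta> \<le> (\<Sum>k\<in>D. (y k - x k)\<^sup>2) \<and> (\<Sum>k\<in>D. (y k - x k)\<^sup>2) \<le> B"
  shows "\<exists>\<alpha>>0. \<exists>c>0. \<forall>n. c * exp (\<alpha> * real n) \<le> christoffel D n x"
proof -
  interpret prob_space \<mu> by (rule prob)
  have fD: "finite D" using D fin by (rule finite_subset)
  \<comment> \<open>Exceeding both \<open>\<delta>\<close> and \<open>B\<close> keeps \<open>\<rho>\<close> positive and the values of \<open>p\<close> on the support nonnegative.\<close>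
  define L where "L = \<bar>B\<bar> + \<delta> + 1"
  define \<rho> where "\<rho> = 1 - \<delta> / L"
  have L: "L > 0" "\<delta> < L" "B \<le> L" using \<delta> by (auto simp: L_def)
  have \<rho>: "0 < \<rho>" "\<rho> < 1" using L \<delta> by (auto simp: \<rho>_def field_simps)
  define p where "p y = 1 + (- 1 / L) * (\<Sum>k\<in>D. 1 * (y k + - x k) ^ 2)" for y
  have p: "p \<in> coordwise_polys D 2"
  proof -
    have "(\<lambda>y. (y k + - x k) ^ 2) \<in> coordwise_polys D (2 * 1)" if "k \<in> D" for k
      using that fD
      by (intro coordwise_polys_power coordwise_polys_add coordwise_polys_coord coordwise_polys_const)
    then show ?thesis
      unfolding p_def
      by (intro coordwise_polys_add coordwise_polys_const[OF fD] coordwise_polys_scale coordwise_polys_sum) simp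
  qed
  have px: "p x = 1" by (simp add: p_def)
  have p_le: "AE y in \<mu>. (p y ^ m)\<^sup>2 \<le> \<rho> ^ (2 * m)" for m
    using sep
  proof eventually_elim
    case (elim y)
    define s where "s = (\<Sum>k\<in>D. (y k - x k)\<^sup>2)"
    have s: "\<delta> \<le> s" "s \<le> L" using elim L by (auto simp: s_def)
    have "p y = 1 - s / L" by (simp add: p_def s_def)
    then have "0 \<le> p y" "p y \<le> \<rho>"
      using s L by (auto simp: \<rho>_def divide_right_mono)
    then have "p y ^ (2 * m) \<le> \<rho> ^ (2 * m)" by (intro power_mono)
    then show ?case by (simp add: power_mult[symmetric] mult.commute)
  qed
  have "\<rho> * exp (- ln \<rho> * real n) \<le> christoffel D n x" for n
  proof -
    \<comment> \<open>\<open>p\<close> has degree 2 in each variable; the factor \<open>\<rho>\<close> in the bound pays for odd \<open>n\<close>.\<close>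
    define m where "m = n div 2"
    define q where "q = (\<lambda>y. p y ^ m)"
    have "q \<in> coordwise_polys D (m * 2)" unfolding q_def by (rule coordwise_polys_power[OF fD p])
    then have q: "q \<in> coordwise_polys D n"
      using coordwise_polys_mono[OF fD order.refl, of "m * 2" n] by (auto simp: m_def)
    have "(\<integral>y. (q y)\<^sup>2 \<partial>\<mu>) \<le> (\<integral>y. \<rho> ^ (2 * m) \<partial>\<mu>)"
      using p_le[of m] poly_integrable[OF D coordwise_polys_power[OF fD q]]
      by (intro integral_mono_AE) (auto simp: q_def)
    then have int: "(\<integral>y. (q y)\<^sup>2 \<partial>\<mu>) \<le> \<rho> ^ (2 * m)" by (simp add: prob_space)
    have "1 = (q x)\<^sup>2" by (simp add: q_def px)
    also have "\<dots> \<le> christoffel D n x * (\<integral>y. (q y)\<^sup>2 \<partial>\<mu>)" by (rule christoffel_lower[OF D q])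
    also have "\<dots> \<le> christoffel D n x * \<rho> ^ (2 * m)"
      using int christoffel_ge_1[OF D, of n x] by (intro mult_left_mono) auto
    finally have ge: "1 \<le> christoffel D n x * \<rho> ^ (2 * m)" .
    have "\<rho> * \<rho> ^ (2 * m) \<le> \<rho> ^ n"
      using \<rho> power_decreasing[of n "Suc (2 * m)" \<rho>] by (simp add: m_def)
    have "exp (- ln \<rho> * real n) = inverse (\<rho> ^ n)"
      using \<rho> by (simp add: exp_minus exp_of_nat2_mult)
    then have "\<rho> * exp (- ln \<rho> * real n) = \<rho> / \<rho> ^ n" by (simp add: divide_inverse)
    also have "\<dots> \<le> \<rho> / \<rho> ^ n * (christoffel D n x * \<rho> ^ (2 * m))"
      using mult_left_mono[OF ge, of "\<rho> / \<rho> ^ n"] \<rho> by simp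
    also have "\<dots> = christoffel D n x * (\<rho> * \<rho> ^ (2 * m) / \<rho> ^ n)" by (simp add: field_simps)
    also have "\<dots> \<le> christoffel D n x * 1"
      using \<open>\<rho> * \<rho> ^ (2 * m) \<le> \<rho> ^ n\<close> \<rho> christoffel_ge_1[OF D, of n x]
      by (intro mult_left_mono) (auto simp: divide_le_eq)
    finally show ?thesis by simp
  qed
  moreover have "- ln \<rho> > 0" using \<rho> by simp
  ultimately show ?thesis using \<rho> by blast
qed

section \<open>The rational Christoffel function along a rooted junction tree\<close>

context bounded_definite
begin

lemma rational_christoffel_enumeration:
  assumes J: "pair_graph J" and cs: "parent_enumeration J cs par" "set cs = pverts J" "cs \<noteq> []"
  shows "rational_christoffel \<mu> J n x =
    christoffel (cs ! 0) n x * (\<Prod>i\<in>{1..<length cs}. christoffel (cs ! i) n x) /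
      (\<Prod>i\<in>{1..<length cs}. christoffel (cs ! par i \<inter> cs ! i) n x)"
proof -
  define g where "g C = christoffel C n x" for C
  have "bij_betw ((!) cs) {..<length cs} (pverts J)"
    using cs by (intro bij_betw_nth) (auto simp: parent_enumeration_def)
  then have "(\<Prod>C\<in>pverts J. g C) = (\<Prod>i<length cs. g (cs ! i))"
    by (rule prod.reindex_bij_betw[symmetric])
  also have "{..<length cs} = insert 0 {1..<length cs}" using cs(3) by (cases cs) auto
  finally have verts: "(\<Prod>C\<in>pverts J. g C) = g (cs ! 0) * (\<Prod>i\<in>{1..<length cs}. g (cs ! i))" by simp
  have edges: "(\<Prod>e\<in>undirected_edges J. g (\<Inter>e)) = (\<Prod>i\<in>{1..<length cs}. g (cs ! par i \<inter> cs ! i))"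
    unfolding parent_enumeration_edges(1)[OF J cs(1,2)]
    by (subst prod.reindex[OF parent_enumeration_edges(2)[OF J cs(1,2)]]) simp
  show ?thesis
    using verts edges unfolding g_def rational_christoffel_def by (simp only:)
qed

text \<open>
  In the enumeration that starts at the given clique, the Christoffel polynomial of every other clique
  is at least that of its intersection with the parent, so dropping these quotients only decreases the
  product.
\<close>

lemma christoffel_root_le_rational:
  assumes J: "junction_tree G J" and G: "pverts G = I" and root: "C\<^sub>0 \<in> pverts J"
  shows "christoffel C\<^sub>0 n x \<le> rational_christoffel \<mu> J n x"
proof -
  have T: "undirected_tree J" using J by (simp add: junction_tree_def)
  then have g: "pair_graph J" by (simp add: undirected_tree_def)
  obtain cs par where cs: "parent_enumeration J cs par" "set cs = pverts J" "cs \<noteq> []" "cs ! 0 = C\<^sub>0"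
    by (rule parent_enumeration_exists[OF T root])
  let ?N = "\<Prod>i\<in>{1..<length cs}. christoffel (cs ! i) n x"
  let ?D = "\<Prod>i\<in>{1..<length cs}. christoffel (cs ! par i \<inter> cs ! i) n x"
  have sub: "cs ! i \<subseteq> I" if "i < length cs" for i
    using junction_tree_cliques(2)[OF J, of "cs ! i"] nth_mem[OF that] by (simp add: cs(2) G)
  have ge1: "1 \<le> christoffel (cs ! par i \<inter> cs ! i) n x" if "i \<in> {1..<length cs}" for i
    using sub[of i] that by (intro christoffel_ge_1) auto
  have "?D \<le> ?N"
  proof (intro prod_mono conjI)
    fix i assume i: "i \<in> {1..<length cs}"
    show "0 \<le> christoffel (cs ! par i \<inter> cs ! i) n x" using ge1[OF i] by simp
    show "christoffel (cs ! par i \<inter> cs ! i) n x \<le> christoffel (cs ! i) n x"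
      using sub[of i] i by (intro christoffel_mono) auto
  qed
  moreover have "1 \<le> ?D" by (intro prod_ge_1 ge1)
  ultimately have "1 \<le> ?N / ?D" by (simp add: le_divide_eq)
  moreover have "0 \<le> christoffel C\<^sub>0 n x"
    using christoffel_ge_1[of "C\<^sub>0" n x] junction_tree_cliques(2)[OF J root] G by simp
  ultimately have "christoffel C\<^sub>0 n x * 1 \<le> christoffel C\<^sub>0 n x * (?N / ?D)" by (rule mult_left_mono)
  then show ?thesis
    unfolding rational_christoffel_enumeration[OF g cs(1-3)] cs(4) by simp
qed

lemma rational_christoffel_bounds:
  assumes J: "junction_tree G J" and G: "pverts G = I"
  shows "0 \<le> rational_christoffel \<mu> J n x"
    and "rational_christoffel \<mu> J n x \<le> (\<Prod>C\<in>pverts J. christoffel C n x)"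
proof -
  have g: "pair_graph J" using J by (simp add: junction_tree_def undirected_tree_def)
  have ge1: "1 \<le> christoffel C n x" if "C \<in> pverts J" for C
    using junction_tree_cliques(2)[OF J that] G by (intro christoffel_ge_1) simp
  have "1 \<le> (\<Prod>e\<in>undirected_edges J. christoffel (\<Inter>e) n x)"
  proof (intro prod_ge_1 christoffel_ge_1)
    fix e assume "e \<in> undirected_edges J"
    then obtain u v where "e = {u, v}" "(u, v) \<in> parcs J" by (auto simp: undirected_edges_def)
    then show "\<Inter>e \<subseteq> I"
      using junction_tree_cliques(2)[OF J pair_graph_verts(1)[OF g]] G by auto
  qed
  moreover have "0 \<le> (\<Prod>C\<in>pverts J. christoffel C n x)"
    using ge1 by (intro prod_nonneg) (meson order_trans zero_le_one)
  ultimately show "0 \<le> rational_christoffel \<mu> J n x"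
    and "rational_christoffel \<mu> J n x \<le> (\<Prod>C\<in>pverts J. christoffel C n x)"
    unfolding rational_christoffel_def by (auto simp: divide_le_eq mult_le_cancel_left1 mult_le_cancel_left2)
qed

end

section \<open>The density is positive where its clique marginals are\<close>

text \<open>
  Let \<open>A\<close> be the union of the first cliques of the enumeration, \<open>B\<close> the next clique and \<open>C\<close> its
  intersection with the parent, so that \<open>C \<subseteq> A\<close>, \<open>C \<subseteq> B\<close> and \<open>C\<close> separates \<open>A\<close> from \<open>B\<close>. Conditional
  independence then says that the product of the marginal densities of \<open>A\<close> and \<open>B\<close> is a multiple of the
  marginal density of \<open>A \<union> B\<close>. So nonzero marginals of the cliques propagate to the whole vertex set.
\<close>

lemma density_nonzero_of_clique_marginals:
  assumes gm: "graphical_model d f G" and J: "junction_tree G J"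
  shows "AE y in lebesgue_on_coords {1..d}.
    (\<forall>C\<in>pverts J. marginal_density d f C (restrict y C) \<noteq> 0) \<longrightarrow>
      marginal_density d f {1..d} (restrict y {1..d}) \<noteq> 0"
proof -
  let ?f = "\<lambda>A y. marginal_density d f A (restrict y A)"
  have G: "pverts G = {1..d}" using gm by (simp add: graphical_model_def)
  have T: "undirected_tree J" using J by (simp add: junction_tree_def)
  obtain R where "R \<in> pverts J" using junction_tree_cliques(1)[OF J] by blast
  then obtain cs par where cs: "parent_enumeration J cs par" "set cs = pverts J" "cs \<noteq> []"
    by (rule parent_enumeration_exists[OF T])
  have sub: "cs ! i \<subseteq> {1..d}" if "i < length cs" for i
    using junction_tree_cliques(2)[OF J, of "cs ! i"] nth_mem[OF that] by (simp add: cs(2) G)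
  \<comment> \<open>The induction starts with one clique, not with none, so that every later clique has a parent.\<close>
  have step: "AE y in lebesgue_on_coords {1..d}.
      (\<forall>i<Suc m. ?f (cs ! i) y \<noteq> 0) \<longrightarrow> ?f (\<Union>i<Suc m. cs ! i) y \<noteq> 0" if "Suc m \<le> length cs" for m
    using that
  proof (induction m)
    case 0
    have "(\<Union>i<Suc 0. cs ! i) = cs ! 0" by (simp add: lessThan_Suc)
    then show ?case
      by (simp only:) (intro AE_I2 impI, erule allE[of _ 0], erule mp, rule zero_less_Suc)
  next
    case (Suc m)
    let ?A = "\<Union>i<Suc m. cs ! i" and ?B = "cs ! Suc m"
    let ?C = "?B \<inter> cs ! par (Suc m)"
    have par: "par (Suc m) < Suc m" using parent_enumerationD(1)[OF cs(1), of "Suc m"] Suc.prems by simp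
    have "separated G ?A ?B ?C"
      using Suc.prems by (intro junction_tree_separated[OF J cs(1,2)]) auto
    moreover have "?A \<subseteq> {1..d}"
      using Suc.prems by (intro UN_least sub) simp
    moreover have B: "?B \<subseteq> {1..d}" using Suc.prems by (intro sub) simp
    moreover have "?C \<subseteq> {1..d}" using B by (rule order_trans[OF Int_lower1])
    ultimately have "cond_indep d f ?A ?B ?C" using gm by (simp only: graphical_model_def)
    then have "AE y in lebesgue_on_coords {1..d}.
        ?f ?C y * ?f (?A \<union> ?B \<union> ?C) y = ?f (?A \<union> ?C) y * ?f (?B \<union> ?C) y"
      by (simp only: cond_indep_def)
    moreover have "?A \<union> ?B \<union> ?C = (\<Union>i<Suc (Suc m). cs ! i)"
      unfolding lessThan_Suc[of "Suc m"] by blast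
    moreover have "cs ! par (Suc m) \<subseteq> ?A" using par by (intro UN_upper) simp
    then have "?A \<union> ?C = ?A" "?B \<union> ?C = ?B" by blast+
    ultimately have ind: "AE y in lebesgue_on_coords {1..d}.
        ?f ?C y * ?f (\<Union>i<Suc (Suc m). cs ! i) y = ?f ?A y * ?f ?B y"
      by (simp only:)
    have "AE y in lebesgue_on_coords {1..d}. (\<forall>i<Suc m. ?f (cs ! i) y \<noteq> 0) \<longrightarrow> ?f ?A y \<noteq> 0"
      using Suc.prems by (intro Suc.IH) simp
    with ind show ?case
    proof eventually_elim
      case (elim y)
      show ?case
      proof
        assume "\<forall>i<Suc (Suc m). ?f (cs ! i) y \<noteq> 0"
        then have "?f ?A y \<noteq> 0" "?f ?B y \<noteq> 0" using elim(2) by auto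
        then have "?f ?A y * ?f ?B y \<noteq> 0" by (rule no_zero_divisors)
        then show "?f (\<Union>i<Suc (Suc m). cs ! i) y \<noteq> 0" unfolding elim(1)[symmetric] by (metis mult_zero_right)
      qed
    qed
  qed
  have len: "Suc (length cs - 1) = length cs" using cs(3) by (cases cs) auto
  have "(\<Union>i<length cs. cs ! i) = {1..d}"
  proof
    show "(\<Union>i<length cs. cs ! i) \<subseteq> {1..d}" using sub by auto
    show "{1..d} \<subseteq> (\<Union>i<length cs. cs ! i)"
    proof
      fix v assume "v \<in> {1..d}"
      then have "v \<in> pverts G" using G by simp
      from junction_tree_cliques(4)[OF J this] obtain C where "C \<in> set cs" "v \<in> C" using cs(2) by auto
      then show "v \<in> (\<Union>i<length cs. cs ! i)" by (auto simp: in_set_conv_nth)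
    qed
  qed
  then have "AE y in lebesgue_on_coords {1..d}. (\<forall>i<length cs. ?f (cs ! i) y \<noteq> 0) \<longrightarrow> ?f {1..d} y \<noteq> 0"
    using step[of "length cs - 1"] by (simp only: len order.refl simp_thms)
  then show ?thesis
    by eventually_elim (use cs(2) in \<open>auto simp: nth_mem\<close>)
qed

lemma marginal_density_full:
  assumes "y \<in> {1..d} \<rightarrow>\<^sub>E UNIV"
  shows "marginal_density d f {1..d} y = f y"
proof -
  have "merge {1..d} {} (y, z) = y" for z
    using assms by (auto simp: merge_def PiE_def extensional_def)
  then show ?thesis by (simp add: marginal_density_def PiM_empty lebesgue_integral_count_space_finite)
qed

section \<open>Measures with a regular density\<close>

locale regular_density =
  fixes d :: nat
    and \<mu> :: "(nat \<Rightarrow> real) measure"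
    and f :: "(nat \<Rightarrow> real) \<Rightarrow> real"
    and S :: "(nat \<Rightarrow> real) set"
  assumes prob: "prob_space \<mu>"
    and f_measurable: "f \<in> borel_measurable (lebesgue_on_coords {1..d})"
    and f_nonneg: "\<forall>y \<in> {1..d} \<rightarrow>\<^sub>E UNIV. f y \<ge> 0"
    and \<mu>_eq: "\<mu> = density (lebesgue_on_coords {1..d}) (\<lambda>y. ennreal (f y))"
    and S_eq: "S = measure_support (powertop_real {1..d}) \<mu>"
    and S_compact: "compactin (powertop_real {1..d}) S"
    and S_regular: "\<And>A. A \<noteq> {} \<Longrightarrow> A \<subseteq> {1..d} \<Longrightarrow>
           proj_set A S = powertop_real A closure_of (powertop_real A interior_of proj_set A S)"
    and density_continuous: "\<And>A. A \<noteq> {} \<Longrightarrow> A \<subseteq> {1..d} \<Longrightarrow>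
           continuous_map
             (subtopology (powertop_real A) (powertop_real A interior_of proj_set A S))
             euclideanreal (marginal_density d f A)"
    and density_pos: "\<And>A y. A \<noteq> {} \<Longrightarrow> A \<subseteq> {1..d} \<Longrightarrow> y \<in> powertop_real A interior_of proj_set A S \<Longrightarrow>
           marginal_density d f A y > 0"
    and density_zero: "\<And>A y. A \<noteq> {} \<Longrightarrow> A \<subseteq> {1..d} \<Longrightarrow> y \<in> (A \<rightarrow>\<^sub>E UNIV) - proj_set A S \<Longrightarrow>
           marginal_density d f A y = 0"
begin

abbreviation projection_interior :: "nat set \<Rightarrow> (nat \<Rightarrow> real) set" where
  "projection_interior A \<equiv> powertop_real A interior_of proj_set A S"

lemma S_subset: "S \<subseteq> {1..d} \<rightarrow>\<^sub>E UNIV"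
  using compactin_subset_topspace[OF S_compact] by simp

lemma proj_set_full: "proj_set {1..d} S = S"
proof -
  have "restrict s {1..d} = s" if "s \<in> S" for s using S_subset that by (auto simp: PiE_restrict)
  then show ?thesis by (auto simp: proj_set_def image_iff)
qed

lemma S_closed: "closedin (powertop_real {1..d}) S"
proof (rule compactin_imp_closedin)
  show "Hausdorff_space (powertop_real {1..d})"
    unfolding Hausdorff_space_product_topology by simp
qed (rule S_compact)

text \<open>
  For \<open>d > 0\<close> this is the assumption on marginal densities for the full set of coordinates. For
  \<open>d = 0\<close> the space has a single point, which is in the support.
\<close>

lemma f_zero_outside:
  assumes y: "y \<in> {1..d} \<rightarrow>\<^sub>E UNIV" "y \<notin> S"
  shows "f y = 0"
proof (cases "d = 0")
  case True
  interpret prob_space \<mu> by (rule prob)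
  have space: "space \<mu> = {\<lambda>_. undefined}" using True by (simp add: \<mu>_eq space_PiM)
  have y_eq: "y = (\<lambda>_. undefined)" using y True by simp
  have "emeasure \<mu> U > 0" if "y \<in> U" "U \<subseteq> {\<lambda>_. undefined}" for U
  proof -
    have "U = space \<mu>" using that y_eq space by auto
    then show ?thesis using emeasure_space_1 by simp
  qed
  then have "y \<in> S"
    unfolding S_eq measure_support_def using y True by (auto dest!: openin_subset)
  then show ?thesis using y by simp
next
  case False
  then have "marginal_density d f {1..d} y = 0"
    using density_zero[of "{1..d}" y] proj_set_full y by auto
  then show ?thesis using marginal_density_full[OF y(1)] by simp
qed

lemma AE_in_S: "AE y in \<mu>. y \<in> S"
proof -
  have "AE y in lebesgue_on_coords {1..d}. 0 < ennreal (f y) \<longrightarrow> y \<in> S"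
    using f_zero_outside by (intro AE_I2) (force simp: space_PiM)
  then show ?thesis
    unfolding \<mu>_eq using f_measurable by (subst AE_density) auto
qed

lemma S_nonempty: "S \<noteq> {}"
proof
  interpret prob_space \<mu> by (rule prob)
  assume "S = {}"
  then show False using AE_in_S by simp
qed

lemma compact_image_S:
  assumes "continuous_map (powertop_real {1..d}) euclideanreal g"
  shows "compact (g ` S)"
  using image_compactin[OF S_compact assms] by simp

lemma bounded_on_coords_exists: "\<exists>R. bounded_on_coords \<mu> {1..d} R"
proof -
  have "\<forall>k\<in>{1..d}. \<exists>b. \<forall>y\<in>S. \<bar>y k\<bar> \<le> b"
  proof
    fix k assume "k \<in> {1..d}"
    then have "compact ((\<lambda>y. y k) ` S)"
      by (intro compact_image_S continuous_map_product_projection)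
    then show "\<exists>b. \<forall>y\<in>S. \<bar>y k\<bar> \<le> b" using compact_imp_bounded by (fastforce simp: bounded_iff)
  qed
  from bchoice[OF this] obtain b where b: "\<And>k y. k \<in> {1..d} \<Longrightarrow> y \<in> S \<Longrightarrow> \<bar>y k\<bar> \<le> b k" by blast
  define R where "R = (\<Sum>k\<in>{1..d}. \<bar>b k\<bar>)"
  have le: "\<bar>y k\<bar> \<le> R" if "k \<in> {1..d}" "y \<in> S" for k y
  proof -
    have "\<bar>y k\<bar> \<le> \<bar>b k\<bar>" using b[OF that] by simp
    also have "\<dots> \<le> R" unfolding R_def using that(1) by (intro member_le_sum) auto
    finally show ?thesis .
  qed
  from AE_in_S have "AE y in \<mu>. \<forall>k\<in>{1..d}. \<bar>y k\<bar> \<le> R" by eventually_elim (use le in blast)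
  moreover have "sets \<mu> = sets (lebesgue_on_coords {1..d})" by (simp add: \<mu>_eq)
  ultimately have "bounded_on_coords \<mu> {1..d} R"
    using prob by (intro bounded_on_coords.intro) simp_all
  then show ?thesis by blast
qed

lemma square_le_at_interior:
  assumes A: "A \<subseteq> {1..d}" and z: "A \<noteq> {} \<Longrightarrow> restrict z A \<in> projection_interior A"
  shows "\<exists>K>0. \<forall>n. \<forall>q\<in>coordwise_polys A n. (q z)\<^sup>2 \<le> K * (real n + 1) ^ card A * (\<integral>y. (q y)\<^sup>2 \<partial>\<mu>)"
proof (cases "A = {}")
  case True
  interpret prob_space \<mu> by (rule prob)
  have "(q z)\<^sup>2 \<le> 1 * (real n + 1) ^ card A * (\<integral>y. (q y)\<^sup>2 \<partial>\<mu>)" if "q \<in> coordwise_polys A n" for q n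
  proof -
    have "q = (\<lambda>_. q z)" using coordwise_polys_cong[OF that] True by (intro ext) simp
    then have "(\<integral>y. (q y)\<^sup>2 \<partial>\<mu>) = (\<integral>y. (q z)\<^sup>2 \<partial>\<mu>)" by metis
    then show ?thesis using True by (simp add: prob_space)
  qed
  then show ?thesis by (intro exI[of _ 1]) simp
next
  case False
  obtain R where "bounded_on_coords \<mu> {1..d} R" using bounded_on_coords_exists by blast
  then interpret bounded_on_coords \<mu> "{1..d}" R .
  have fA: "finite A" using A by (rule finite_subset) simp
  obtain \<epsilon> c where \<epsilon>: "\<epsilon> > 0" "c > 0"
    and dens: "\<forall>y\<in>(\<Pi>\<^sub>E k\<in>A. {restrict z A k - \<epsilon>..restrict z A k + \<epsilon>}). c \<le> marginal_density d f A y"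
    using continuous_positive_on_box[OF fA openin_interior_of z density_continuous] density_pos[OF False A z] A False
    by blast
  have "(q z)\<^sup>2 \<le> ((2 / (pi * \<epsilon>)) ^ card A / c) * (real n + 1) ^ card A * (\<integral>y. (q y)\<^sup>2 \<partial>\<mu>)"
    if q: "q \<in> coordwise_polys A n" for q n
  proof -
    have "(q (restrict z A))\<^sup>2 \<le> ((2 / (pi * \<epsilon>) * (real n + 1)) ^ card A / c) * (\<integral>y. (q y)\<^sup>2 \<partial>\<mu>)"
      using dens by (intro square_le_interior[OF f_measurable f_nonneg \<mu>_eq refl A \<epsilon> _ q]) blast
    moreover have "q (restrict z A) = q z" by (rule coordwise_polys_cong[OF q]) simp
    moreover have "(2 / (pi * \<epsilon>) * (real n + 1)) ^ card A / c = (2 / (pi * \<epsilon>)) ^ card A / c * (real n + 1) ^ card A"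
      by (subst power_mult_distrib) (rule times_divide_eq_left[symmetric])
    ultimately show ?thesis by (simp only:)
  qed
  then show ?thesis using \<epsilon> by (intro exI[of _ "(2 / (pi * \<epsilon>)) ^ card A / c"]) auto
qed

lemma projection_interior_nonempty:
  assumes "A \<noteq> {}" "A \<subseteq> {1..d}"
  shows "projection_interior A \<noteq> {}"
proof
  assume "projection_interior A = {}"
  then have "proj_set A S = {}" using S_regular[OF assms] by simp
  then show False using S_nonempty by (simp add: proj_set_def)
qed

text \<open>
  A polynomial of norm 0 vanishes at all interior points of the projected support by
  \<open>square_le_at_interior\<close>. There are such points, and they contain a box.
\<close>

lemma bounded_definite_exists: "\<exists>R. bounded_definite \<mu> {1..d} R"
proof -
  obtain R where R: "bounded_on_coords \<mu> {1..d} R" using bounded_on_coords_exists by blast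
  have "p = (\<lambda>_. 0)" if D: "D \<subseteq> {1..d}" and p: "p \<in> coordwise_polys D n" and int: "(\<integral>y. (p y)\<^sup>2 \<partial>\<mu>) = 0" for D n p
  proof -
    have fD: "finite D" using D by (rule finite_subset) simp
    have zero: "p z = 0" if z: "D \<noteq> {} \<Longrightarrow> restrict z D \<in> projection_interior D" for z
    proof -
      obtain K where "\<forall>n. \<forall>q\<in>coordwise_polys D n. (q z)\<^sup>2 \<le> K * (real n + 1) ^ card D * (\<integral>y. (q y)\<^sup>2 \<partial>\<mu>)"
        using square_le_at_interior[OF D z] by blast
      then have "(p z)\<^sup>2 \<le> K * (real n + 1) ^ card D * (\<integral>y. (p y)\<^sup>2 \<partial>\<mu>)" using p by blast
      then show ?thesis by (simp add: int)
    qed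
    show ?thesis
    proof (cases "D = {}")
      case True
      then show ?thesis using zero by (intro ext) simp
    next
      case False
      obtain z where z: "z \<in> projection_interior D" using projection_interior_nonempty[OF False D] by blast
      from open_contains_box[OF fD openin_interior_of z]
      obtain \<epsilon> where \<epsilon>: "\<epsilon> > 0" "(\<Pi>\<^sub>E k\<in>D. {z k - \<epsilon>..z k + \<epsilon>}) \<subseteq> projection_interior D"
        by (elim exE conjE) (rule that)
      show ?thesis
      proof (rule coordwise_polys_eq_0[OF fD p \<epsilon>(1)])
        fix x assume x: "\<And>k. k \<in> D \<Longrightarrow> \<bar>x k - z k\<bar> \<le> \<epsilon>"
        have "restrict x D \<in> (\<Pi>\<^sub>E k\<in>D. {z k - \<epsilon>..z k + \<epsilon>})"
          unfolding restrict_PiE_iff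
        proof (rule ballI)
          fix k assume "k \<in> D"
          then show "x k \<in> {z k - \<epsilon>..z k + \<epsilon>}" using x[OF \<open>k \<in> D\<close>] by (simp add: abs_le_iff)
        qed
        then show "p x = 0" using \<epsilon>(2) by (intro zero) blast
      qed
    qed
  qed
  then have "bounded_definite \<mu> {1..d} R"
    using R by (intro bounded_definite.intro bounded_definite_axioms.intro) blast+
  then show ?thesis by blast
qed

lemma christoffel_interior_bound:
  assumes A: "A \<subseteq> {1..d}" and x: "A \<noteq> {} \<Longrightarrow> restrict x A \<in> projection_interior A"
  shows "\<exists>K>0. \<forall>n. christoffel_poly A n (marginal \<mu> A) (restrict x A) \<le> K * (real n + 1) ^ card A"
proof -
  obtain R where "bounded_definite \<mu> {1..d} R" using bounded_definite_exists by blast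
  then interpret bounded_definite \<mu> "{1..d}" R .
  obtain K where K: "K > 0"
    "\<And>n q. q \<in> coordwise_polys A n \<Longrightarrow> (q x)\<^sup>2 \<le> K * (real n + 1) ^ card A * (\<integral>y. (q y)\<^sup>2 \<partial>\<mu>)"
    using square_le_at_interior[OF A x] by blast
  have "christoffel A n x \<le> K * (real n + 1) ^ card A" for n
    using K by (intro christoffel_upper[OF A]) auto
  then show ?thesis using K(1) by blast
qed

text \<open>
  The squared distance to \<open>x\<close> in the coordinates of \<open>A\<close> is continuous and does not vanish on the
  compact support, so it is bounded and bounded away from 0 there.
\<close>

lemma christoffel_exterior_bound:
  assumes A: "A \<subseteq> {1..d}" and x: "restrict x A \<notin> proj_set A S"
  shows "\<exists>\<alpha>>0. \<exists>c>0. \<forall>n. c * exp (\<alpha> * real n) \<le> christoffel_poly A n (marginal \<mu> A) (restrict x A)"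
proof -
  obtain R where "bounded_definite \<mu> {1..d} R" using bounded_definite_exists by blast
  then interpret bounded_definite \<mu> "{1..d}" R .
  have fA: "finite A" using A by (rule finite_subset) simp
  define g where "g y = (\<Sum>k\<in>A. (y k - x k)\<^sup>2)" for y
  have "continuous_map (powertop_real {1..d}) euclideanreal g"
    unfolding g_def power2_eq_square using A fA
    by (intro continuous_map_sum continuous_map_real_mult continuous_map_diff
          continuous_map_product_projection) auto
  then have cpt: "compact (g ` S)" by (rule compact_image_S)
  have "0 \<notin> g ` S"
  proof
    assume "0 \<in> g ` S"
    then obtain y where y: "y \<in> S" "g y = 0" by auto
    then have "\<forall>k\<in>A. y k = x k"
      using sum_nonneg_eq_0_iff[OF fA, of "\<lambda>k. (y k - x k)\<^sup>2"] by (simp add: g_def)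
    then have "restrict x A = restrict y A" by (auto simp: restrict_def)
    then show False using x y(1) by (auto simp: proj_set_def)
  qed
  then have "open (- g ` S)" "0 \<in> - g ` S" using compact_imp_closed[OF cpt] by auto
  then obtain \<delta> where \<delta>: "\<delta> > 0" "ball 0 \<delta> \<subseteq> - g ` S" using open_contains_ball by blast
  obtain B where B: "\<And>y. y \<in> S \<Longrightarrow> \<bar>g y\<bar> \<le> B"
    using compact_imp_bounded[OF cpt] by (auto simp: bounded_iff)
  have le: "\<delta> \<le> g y \<and> g y \<le> B" if "y \<in> S" for y
  proof -
    have "g y \<notin> ball 0 \<delta>" using \<delta>(2) that by auto
    moreover have "0 \<le> g y" unfolding g_def by (intro sum_nonneg) simp
    ultimately show ?thesis using B[OF that] by auto
  qed
  from AE_in_S have "AE y in \<mu>. \<delta> \<le> g y \<and> g y \<le> B" by eventually_elim (rule le)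
  then show ?thesis unfolding g_def by (rule christoffel_exponential_growth[OF A \<delta>(1)])
qed

lemma in_projection_interior:
  assumes "A \<noteq> {}" "A \<subseteq> {1..d}" "restrict x A \<in> proj_set A S"
    and "restrict x A \<notin> powertop_real A frontier_of proj_set A S"
  shows "restrict x A \<in> projection_interior A"
proof -
  have "proj_set A S \<subseteq> topspace (powertop_real A)" by (auto simp: proj_set_def)
  then have "restrict x A \<in> powertop_real A closure_of proj_set A S"
    using assms(3) closure_of_subset by blast
  then show ?thesis using assms(4) by (simp add: frontier_of_def)
qed

text \<open>
  Suppose that all projections of \<open>x\<close> on cliques are in the projected support. Not being on the
  boundary, they are interior, so all clique marginals are positive on a neighbourhood of \<open>x\<close>, which
  can be taken disjoint from the closed set \<open>S\<close>. Then the density is nonzero almost everywhere on this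
  neighbourhood; but it vanishes outside \<open>S\<close>, and the neighbourhood has positive Lebesgue measure.
\<close>

lemma exterior_clique:
  assumes gm: "graphical_model d f G" and J: "junction_tree G J"
    and x: "x \<in> {1..d} \<rightarrow>\<^sub>E UNIV" "x \<notin> S"
    and frontier: "\<And>A. A \<noteq> {} \<Longrightarrow> A \<subseteq> {1..d} \<Longrightarrow>
           restrict x A \<notin> powertop_real A frontier_of proj_set A S"
  shows "\<exists>C\<in>pverts J. restrict x C \<notin> proj_set C S"
proof (rule ccontr)
  assume "\<not> ?thesis"
  then have all: "\<And>C. C \<in> pverts J \<Longrightarrow> restrict x C \<in> proj_set C S" by blast
  interpret product_sigma_finite "\<lambda>_::nat. lborel" by standard
  let ?X = "powertop_real {1..d}"
  have G: "pverts G = {1..d}" using gm by (simp add: graphical_model_def)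
  have "d \<noteq> 0"
  proof
    assume d: "d = 0"
    obtain s where s: "s \<in> S" using S_nonempty by blast
    then have "s = x" using S_subset x(1) d by auto
    then show False using s x(2) by simp
  qed
  then have "pverts G \<noteq> {}" using G by simp
  have fin: "finite (pverts J)"
    using J by (intro pair_graph_finite) (simp add: junction_tree_def undirected_tree_def)
  have C: "C \<noteq> {}" "C \<subseteq> {1..d}" if "C \<in> pverts J" for C
    using junction_tree_cliques(6)[OF J that \<open>pverts G \<noteq> {}\<close>] junction_tree_cliques(2)[OF J that] G by auto
  have xW: "restrict x C \<in> projection_interior C" if "C \<in> pverts J" for C
    using that by (intro in_projection_interior C all frontier)
  define N where "N = (\<Inter>C\<in>pverts J. {y \<in> topspace ?X. restrict y C \<in> projection_interior C}) \<inter> topspace ?X - S"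
  have "openin ?X N"
    unfolding N_def
  proof (intro openin_diff openin_INT fin S_closed)
    fix C assume CJ: "C \<in> pverts J"
    have "continuous_map ?X (powertop_real C) (\<lambda>y. restrict y C)"
      unfolding continuous_map_componentwise
    proof (intro conjI ballI)
      fix k assume k: "k \<in> C"
      then have "continuous_map ?X euclideanreal (\<lambda>y. y k)"
        using C(2)[OF CJ] by (intro continuous_map_product_projection) auto
      then show "continuous_map ?X euclideanreal (\<lambda>y. restrict y C k)" using k by simp
    qed auto
    then show "openin ?X {y \<in> topspace ?X. restrict y C \<in> projection_interior C}"
      by (rule openin_continuous_map_preimage) simp
  qed
  moreover have "x \<in> N" using x xW by (simp add: N_def)
  ultimately obtain \<epsilon> where \<epsilon>: "\<epsilon> > 0" "(\<Pi>\<^sub>E k\<in>{1..d}. {x k - \<epsilon>..x k + \<epsilon>}) \<subseteq> N" (is "?B \<subseteq> N")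
    using open_contains_box[of "{1..d}" N x] by auto
  have "AE y in lebesgue_on_coords {1..d}. y \<notin> ?B"
    using density_nonzero_of_clique_marginals[OF gm J]
  proof eventually_elim
    case (elim y)
    show ?case
    proof
      assume "y \<in> ?B"
      then have y: "y \<in> N" using \<epsilon>(2) by blast
      then have ext: "y \<in> {1..d} \<rightarrow>\<^sub>E UNIV" "y \<notin> S" by (auto simp: N_def)
      have "marginal_density d f C (restrict y C) \<noteq> 0" if "C \<in> pverts J" for C
      proof -
        have "restrict y C \<in> projection_interior C" using y that by (auto simp: N_def)
        from density_pos[OF C[OF that] this] show ?thesis by simp
      qed
      then have "marginal_density d f {1..d} (restrict y {1..d}) \<noteq> 0" using elim by blast
      then show False
        using ext f_zero_outside marginal_density_full[OF ext(1)] by (simp add: PiE_restrict)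
    qed
  qed
  moreover have "?B \<in> sets (lebesgue_on_coords {1..d})" by (intro sets_PiM_I_finite) auto
  ultimately have "emeasure (lebesgue_on_coords {1..d}) ?B = 0"
    using AE_iff_measurable[of ?B "lebesgue_on_coords {1..d}" "\<lambda>y. y \<notin> ?B"]
    by (auto simp: space_PiM PiE_def)
  moreover have "emeasure (lebesgue_on_coords {1..d}) ?B = (\<Prod>k\<in>{1..d}. ennreal (2 * \<epsilon>))"
    using \<epsilon>(1) by (subst emeasure_PiM) auto
  ultimately show False using \<epsilon>(1) by simp
qed


end

theorem theorem4p7:
  fixes d :: nat
    and \<mu> :: "(nat \<Rightarrow> real) measure"
    and f :: "(nat \<Rightarrow> real) \<Rightarrow> real"
    and S :: "(nat \<Rightarrow> real) set"
    and G :: "nat pair_pre_digraph"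
    and J :: "nat set pair_pre_digraph"
    and x :: "nat \<Rightarrow> real"
  assumes "prob_space \<mu>"
    and "f \<in> borel_measurable (lebesgue_on_coords {1..d})"
    and "\<forall>y \<in> {1..d} \<rightarrow>\<^sub>E UNIV. f y \<ge> 0"
    and "\<mu> = density (lebesgue_on_coords {1..d}) (\<lambda>y. ennreal (f y))"
    and "S = measure_support (powertop_real {1..d}) \<mu>"
    and "compactin (powertop_real {1..d}) S"
    and "\<And>A. A \<noteq> {} \<Longrightarrow> A \<subseteq> {1..d} \<Longrightarrow>
           proj_set A S = powertop_real A closure_of (powertop_real A interior_of proj_set A S)"
    and "\<And>A. A \<noteq> {} \<Longrightarrow> A \<subseteq> {1..d} \<Longrightarrow>
           continuous_map
             (subtopology (powertop_real A) (powertop_real A interior_of proj_set A S))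
             euclideanreal (marginal_density d f A)"
    and "\<And>A y. A \<noteq> {} \<Longrightarrow> A \<subseteq> {1..d} \<Longrightarrow> y \<in> powertop_real A interior_of proj_set A S \<Longrightarrow>
           marginal_density d f A y > 0"
    and "\<And>A y. A \<noteq> {} \<Longrightarrow> A \<subseteq> {1..d} \<Longrightarrow> y \<in> (A \<rightarrow>\<^sub>E UNIV) - proj_set A S \<Longrightarrow>
           marginal_density d f A y = 0"
    and "graphical_model d f G"
    and "junction_tree G J"
    and "x \<in> {1..d} \<rightarrow>\<^sub>E UNIV"
    and "\<And>A. A \<noteq> {} \<Longrightarrow> A \<subseteq> {1..d} \<Longrightarrow>
           restrict x A \<notin> powertop_real A frontier_of proj_set A S"
  shows "\<exists>\<alpha>>0.
      (x \<in> powertop_real {1..d} interior_of S \<longrightarrow>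
         (\<lambda>n. rational_christoffel \<mu> J n x) \<in> O(\<lambda>n. real n ^ (d\<^sup>2))) \<and>
      (x \<notin> S \<longrightarrow>
         (\<lambda>n. rational_christoffel \<mu> J n x) \<in> \<Omega>(\<lambda>n. exp (\<alpha> * real n)))"
proof -
  interpret regular_density d \<mu> f S
    by (rule regular_density.intro) (fact assms(1-10))+
  obtain R where "bounded_definite \<mu> {1..d} R" using bounded_definite_exists by blast
  then interpret bounded_definite \<mu> "{1..d}" R .
  note J = \<open>junction_tree G J\<close> and gm = \<open>graphical_model d f G\<close> and x = assms(13) and frontier = assms(14)
  have G: "pverts G = {1..d}" using gm by (simp add: graphical_model_def)
  have C: "C \<subseteq> {1..d}" if "C \<in> pverts J" for C
    using junction_tree_cliques(2)[OF J that] G by simp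
  have upper: "(\<lambda>n. rational_christoffel \<mu> J n x) \<in> O(\<lambda>n. real n ^ (d\<^sup>2))" if int: "x \<in> projection_interior {1..d}" "x \<in> S"
  proof -
    have "\<exists>K>0. \<forall>n. christoffel C n x \<le> K * (real n + 1) ^ card C" if CJ: "C \<in> pverts J" for C
    proof (rule christoffel_interior_bound[OF C[OF CJ]])
      assume "C \<noteq> {}"
      moreover have "restrict x C \<in> proj_set C S" using int by (simp add: proj_set_def)
      ultimately show "restrict x C \<in> projection_interior C" using C[OF CJ] by (intro in_projection_interior frontier) auto
    qed
    then have "\<forall>C\<in>pverts J. \<exists>K. K > 0 \<and> (\<forall>n. christoffel C n x \<le> K * (real n + 1) ^ card C)" by blast
    from bchoice[OF this] obtain K where K: "\<And>C. C \<in> pverts J \<Longrightarrow> K C > 0"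
      "\<And>C n. C \<in> pverts J \<Longrightarrow> christoffel C n x \<le> K C * (real n + 1) ^ card C" by blast
    have deg: "(\<Sum>C\<in>pverts J. card C) \<le> d\<^sup>2"
    proof (cases "d = 0")
      case True
      then have "card C = 0" if "C \<in> pverts J" for C using C[OF that] by simp
      then show ?thesis by (simp add: sum.neutral)
    next
      case False
      have "(\<Sum>C\<in>pverts J. card C) \<le> (\<Sum>C\<in>pverts J. d)"
        using card_mono[OF _ C] by (intro sum_mono) force
      also have "\<dots> = card (pverts J) * d" by simp
      also have "\<dots> \<le> d * d"
        using junction_tree_card_le[OF J] G False by (intro mult_right_mono) auto
      finally show ?thesis by (simp add: power2_eq_square)
    qed
    have bound: "rational_christoffel \<mu> J n x \<le> (\<Prod>C\<in>pverts J. K C) * 2 ^ d\<^sup>2 * real n ^ d\<^sup>2" if n: "n \<ge> 1" for n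
    proof -
      have "rational_christoffel \<mu> J n x \<le> (\<Prod>C\<in>pverts J. christoffel C n x)"
        by (rule rational_christoffel_bounds(2)[OF J G])
      also have "\<dots> \<le> (\<Prod>C\<in>pverts J. K C * (real n + 1) ^ card C)"
        using K christoffel_ge_1[OF C] by (intro prod_mono) (meson order_trans zero_le_one)
      also have "\<dots> = (\<Prod>C\<in>pverts J. K C) * (real n + 1) ^ (\<Sum>C\<in>pverts J. card C)"
        by (simp add: prod.distrib power_sum)
      also have "\<dots> \<le> (\<Prod>C\<in>pverts J. K C) * (2 * real n) ^ d\<^sup>2"
      proof (intro mult_left_mono)
        have "(real n + 1) ^ (\<Sum>C\<in>pverts J. card C) \<le> (real n + 1) ^ d\<^sup>2"
          by (intro power_increasing deg) simp
        also have "\<dots> \<le> (2 * real n) ^ d\<^sup>2" using n by (intro power_mono) auto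
        finally show "(real n + 1) ^ (\<Sum>C\<in>pverts J. card C) \<le> (2 * real n) ^ d\<^sup>2" .
        show "0 \<le> (\<Prod>C\<in>pverts J. K C)" using K(1) by (intro prod_nonneg) (simp add: less_imp_le)
      qed
      finally show ?thesis by (simp add: power_mult_distrib)
    qed
    show ?thesis
    proof (rule bigoI)
      show "\<forall>\<^sub>F n in sequentially. norm (rational_christoffel \<mu> J n x) \<le>
          ((\<Prod>C\<in>pverts J. K C) * 2 ^ d\<^sup>2) * norm (real n ^ d\<^sup>2)"
        using eventually_ge_at_top[of 1]
      proof eventually_elim
        case (elim n)
        show ?case using bound[OF elim] rational_christoffel_bounds(1)[OF J G, of n x] by simp
      qed
    qed
  qed
  show ?thesis
  proof (cases "x \<in> S")
    case True
    show ?thesis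
    proof (intro exI[of _ 1] conjI impI)
      assume "x \<in> powertop_real {1..d} interior_of S"
      then show "(\<lambda>n. rational_christoffel \<mu> J n x) \<in> O(\<lambda>n. real n ^ (d\<^sup>2))"
        using True by (intro upper) (simp_all only: proj_set_full)
    qed (use True in simp_all)
  next
    case False
    obtain C\<^sub>0 where root: "C\<^sub>0 \<in> pverts J" "restrict x C\<^sub>0 \<notin> proj_set C\<^sub>0 S"
      using exterior_clique[OF gm J x False frontier] by blast
    obtain \<alpha> c where \<alpha>: "\<alpha> > 0" "c > 0" "\<And>n. c * exp (\<alpha> * real n) \<le> christoffel C\<^sub>0 n x"
      using christoffel_exterior_bound[OF C[OF root(1)] root(2)] by blast
    have "(\<lambda>n. rational_christoffel \<mu> J n x) \<in> \<Omega>(\<lambda>n. exp (\<alpha> * real n))"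
    proof (rule landau_omega.bigI[OF \<alpha>(2)], intro always_eventually allI)
      fix n
      have "c * exp (\<alpha> * real n) \<le> rational_christoffel \<mu> J n x"
        using \<alpha>(3)[of n] christoffel_root_le_rational[OF J G root(1), of n x] by (rule order_trans)
      then show "c * norm (exp (\<alpha> * real n)) \<le> norm (rational_christoffel \<mu> J n x)" by simp
    qed
    moreover have "x \<notin> powertop_real {1..d} interior_of S"
      using False interior_of_subset[of "powertop_real {1..d}" S] by blast
    ultimately show ?thesis using \<alpha>(1) by blast
  qed
qed

end
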